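(* Let $d\ge 1$. The square root velocity transform $R : AC_0(I,\mathbb{R}^d) \to L^2(I,\mathbb{R}^d)$ is a homeomorphism.
   Context: $I=[0,1]$. $AC_0(I,\mathbb{R}^d)$ is the Banach space of absolutely continuous curves $c : I \to \mathbb{R}^d$ with $c(0)=0$, with norm $\|c\|_{AC} = \|c'\|_{L^1}$. The map $V:\mathbb{R}^d\to\mathbb{R}^d$ is $V(x) = \frac{x}{\sqrt{|x|}}$ for $x\neq 0$ and $V(0)=0$. The square root velocity transform is $R(c)(t) = V(c'(t))$. *)

theory Defs
  imports "HOL-Analysis.Analysis"
begin

abbreviation I01 :: "real set"
  where "I01 \<equiv> {0..1}"

definition absolutely_continuous_curve :: "(real \<Rightarrow> real ^ 'n) \<Rightarrow> bool" where
  "absolutely_continuous_curve c \<longleftrightarrow>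
     (\<forall>\<epsilon>>0. \<exists>\<delta>>0. \<forall>(m::nat) a b.
        (\<forall>i<m. a i \<in> I01 \<and> b i \<in> I01 \<and> a i < b i) \<and>
        disjoint_family_on (\<lambda>i. {a i<..<b i}) {..<m} \<and>
        (\<Sum>i<m. b i - a i) < \<delta>
        \<longrightarrow> (\<Sum>i<m. norm (c (b i) - c (a i))) < \<epsilon>)"

text \<open>
  A curve on the unit interval is represented by a function on the reals that is
  \<^const>\<open>undefined\<close> outside the interval, so that equality of curves is equality in HOL.
\<close>

definition AC0 :: "(real \<Rightarrow> real ^ 'n) set" where
  "AC0 = {c. c \<in> extensional I01 \<and> absolutely_continuous_curve c \<and> c 0 = 0}"

text \<open>
  The derivative exists almost everywhere for absolutely continuous curves; on the
  remaining null set the value of \<^const>\<open>vector_derivative\<close> is arbitrary and irrelevant to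
  everything below.
\<close>

definition velocity :: "(real \<Rightarrow> real ^ 'n) \<Rightarrow> real \<Rightarrow> real ^ 'n" where
  "velocity c t = vector_derivative c (at t within I01)"

definition AC_norm :: "(real \<Rightarrow> real ^ 'n) \<Rightarrow> real" where
  "AC_norm c = (LINT t|lebesgue_on I01. norm (velocity c t))"

definition AC_dist :: "(real \<Rightarrow> real ^ 'n) \<Rightarrow> (real \<Rightarrow> real ^ 'n) \<Rightarrow> real" where
  "AC_dist c d = AC_norm (\<lambda>t. c t - d t)"

definition AC0_topology :: "(real \<Rightarrow> real ^ 'n) topology" where
  "AC0_topology = Metric_space.mtopology AC0 AC_dist"

definition square_integrable :: "(real \<Rightarrow> real ^ 'n) set" where
  "square_integrable = {f. f \<in> borel_measurable (lebesgue_on I01) \<and>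
     integrable (lebesgue_on I01) (\<lambda>t. (norm (f t))\<^sup>2)}"

definition ae_eq :: "((real \<Rightarrow> real ^ 'n) \<times> (real \<Rightarrow> real ^ 'n)) set" where
  "ae_eq = {(f, g). f \<in> square_integrable \<and> g \<in> square_integrable \<and>
     (AE t in lebesgue_on I01. f t = g t)}"

definition L2 :: "(real \<Rightarrow> real ^ 'n) set set" where
  "L2 = square_integrable // ae_eq"

text \<open>
  The equivalence class of a function, which is empty (hence not an element of
  \<^const>\<open>L2\<close>) if the function is not square integrable.
\<close>

definition L2_class :: "(real \<Rightarrow> real ^ 'n) \<Rightarrow> (real \<Rightarrow> real ^ 'n) set" where
  "L2_class f = ae_eq `` {f}"

definition L2_dist :: "(real \<Rightarrow> real ^ 'n) set \<Rightarrow> (real \<Rightarrow> real ^ 'n) set \<Rightarrow> real" where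
  "L2_dist F G = (let f = (SOME f. f \<in> F); g = (SOME g. g \<in> G)
     in sqrt (LINT t|lebesgue_on I01. (norm (f t - g t))\<^sup>2))"

definition L2_topology :: "(real \<Rightarrow> real ^ 'n) set topology" where
  "L2_topology = Metric_space.mtopology L2 L2_dist"

definition V :: "real ^ 'n \<Rightarrow> real ^ 'n" where
  "V x = (if x = 0 then 0 else x /\<^sub>R sqrt (norm x))"

definition SRVT :: "(real \<Rightarrow> real ^ 'n) \<Rightarrow> (real \<Rightarrow> real ^ 'n) set" where
  "SRVT c = L2_class (\<lambda>t. V (velocity c t))"

lemma equiv_ae_eq: "equiv square_integrable ae_eq"
proof (rule equivI)
  show "ae_eq \<subseteq> (square_integrable \<times> square_integrable :: ((real \<Rightarrow> real ^ 'n) \<times> _) set)"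
    by (auto simp: ae_eq_def)
  show "refl_on square_integrable (ae_eq :: ((real \<Rightarrow> real ^ 'n) \<times> _) set)"
    by (auto simp: refl_on_def ae_eq_def)
  show "sym (ae_eq :: ((real \<Rightarrow> real ^ 'n) \<times> _) set)"
    by (auto simp: sym_def ae_eq_def elim: AE_mp)
  show "trans (ae_eq :: ((real \<Rightarrow> real ^ 'n) \<times> _) set)"
    unfolding trans_def ae_eq_def by (auto elim!: eventually_elim2)
qed

text \<open>The distance does not depend on the chosen representatives.\<close>

lemma L2_dist_class:
  assumes "f \<in> square_integrable" "g \<in> square_integrable"
  shows "L2_dist (L2_class f) (L2_class g) =
    sqrt (LINT t|lebesgue_on I01. (norm (f t - g t))\<^sup>2)"
proof -
  define f' where "f' = (SOME h. h \<in> L2_class f)"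
  define g' where "g' = (SOME h. h \<in> L2_class g)"
  have "f \<in> L2_class f" "g \<in> L2_class g"
    using assms by (auto simp: L2_class_def ae_eq_def)
  then have "f' \<in> L2_class f" "g' \<in> L2_class g"
    unfolding f'_def g'_def by (metis someI)+
  then have sq: "f' \<in> square_integrable" "g' \<in> square_integrable"
    and ae: "AE t in lebesgue_on I01. f t = f' t" "AE t in lebesgue_on I01. g t = g' t"
    by (auto simp: L2_class_def ae_eq_def)
  have [measurable]: "f \<in> borel_measurable (lebesgue_on I01)"
    "g \<in> borel_measurable (lebesgue_on I01)" "f' \<in> borel_measurable (lebesgue_on I01)"
    "g' \<in> borel_measurable (lebesgue_on I01)"
    using assms sq by (auto simp: square_integrable_def)
  have "AE t in lebesgue_on I01. (norm (f' t - g' t))\<^sup>2 = (norm (f t - g t))\<^sup>2"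
    using ae by eventually_elim simp
  then have "(LINT t|lebesgue_on I01. (norm (f' t - g' t))\<^sup>2) =
      (LINT t|lebesgue_on I01. (norm (f t - g t))\<^sup>2)"
    by (intro integral_cong_AE) auto
  then show ?thesis
    by (simp add: L2_dist_def f'_def g'_def)
qed

end

theory Submission
  imports Defs
begin

text \<open>
  The map \<^term>\<open>SRVT\<close> factors through the velocity. Differentiation identifies the absolutely
  continuous curves starting at \<open>0\<close> isometrically with the integrable functions on the unit
  interval, and \<^const>\<open>V\<close>, applied pointwise, identifies integrable with square integrable functions.

  The first identification is Lebesgue's fundamental theorem of calculus. Its two halves have
  independent proofs. An absolutely continuous curve is an indefinite integral
  (\<open>abs_cont_eq_integral\<close>): each coordinate is a difference of two monotone absolutely continuous
  functions, built from the total variation, and the Stieltjes measure of a monotone absolutely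
  continuous function has no mass on Lebesgue null sets, so Radon-Nikodym gives its density.
  Conversely, an indefinite integral has the integrand as its derivative almost everywhere
  (\<open>integral_has_vector_derivative_AE\<close>): a set where the integrand lies below \<open>a\<close> although
  arbitrarily short intervals have averages above \<open>b > a\<close> is null. By Vitali's theorem disjoint such
  intervals cover it up to a null set within an open set only slightly larger than the sublevel set,
  while the integral of the integrand minus \<open>a\<close> over these intervals is both at least \<open>b - a\<close> times
  their length and at most the small contribution from outside the sublevel set.

  For the second identification, the inverse of \<^const>\<open>V\<close> is \<open>y \<mapsto> \<bar>y\<bar> y\<close>, and \<open>\<bar>V x\<bar>\<^sup>2 = \<bar>x\<bar>\<close>. Two
  pointwise estimates give continuity in both directions. The map \<^const>\<open>V\<close> is Hoelder continuous with
  exponent \<open>1/2\<close>, \<open>\<bar>V x - V y\<bar>\<^sup>2 \<le> 2 \<bar>x - y\<bar>\<close> (\<open>norm_V_diff\<close>), so the squared \<open>L\<^sup>2\<close> distance of the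
  images is at most twice the distance of the curves. Its inverse is Lipschitz with a constant growing
  like \<open>\<bar>p\<bar> + \<bar>q\<bar>\<close>, which after Young's inequality integrates to a modulus of continuity at each
  fixed square integrable function (\<open>norm_V_inv_diff\<close>).
\<close>

section \<open>Absolute continuity\<close>

text \<open>
  Degenerate intervals are admitted, and only the interiors have to be disjoint. Hence the class is
  stable under truncating all intervals at a common point, which is how intervals are split below.
\<close>

definition nonoverlapping :: "real \<Rightarrow> real \<Rightarrow> 'i set \<Rightarrow> ('i \<Rightarrow> real) \<Rightarrow> ('i \<Rightarrow> real) \<Rightarrow> bool" where
  "nonoverlapping x y S a b \<longleftrightarrow> finite S \<and> (\<forall>i\<in>S. x \<le> a i \<and> a i \<le> b i \<and> b i \<le> y) \<and>
     disjoint_family_on (\<lambda>i. {a i<..<b i}) S"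

text \<open>
  Absolute continuity on the unit interval, for functions with values in any normed space: it is needed for
  curves, for their coordinates and for their total variation.
\<close>

definition abs_cont :: "(real \<Rightarrow> 'a::real_normed_vector) \<Rightarrow> bool" where
  "abs_cont f \<longleftrightarrow> (\<forall>\<epsilon>>0. \<exists>\<delta>>0. \<forall>(S::nat set) a b.
     nonoverlapping 0 1 S a b \<and> (\<Sum>i\<in>S. b i - a i) < \<delta> \<longrightarrow> (\<Sum>i\<in>S. norm (f (b i) - f (a i))) < \<epsilon>)"

lemma nonoverlapping_reindex:
  assumes "nonoverlapping x y S a b" "bij_betw h T S"
  shows "nonoverlapping x y T (a \<circ> h) (b \<circ> h)"
proof -
  have "finite T"
    using assms bij_betw_finite unfolding nonoverlapping_def by blast
  moreover have "disjoint_family_on (\<lambda>i. {a (h i)<..<b (h i)}) T"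
    using assms unfolding nonoverlapping_def disjoint_family_on_def bij_betw_def inj_on_def
    by (metis (no_types, lifting) image_eqI)
  ultimately show ?thesis
    using assms unfolding nonoverlapping_def by (auto simp: bij_betw_def)
qed

lemma nonoverlapping_mono:
  assumes "nonoverlapping x y S a b" "x' \<le> x" "y \<le> y'" "T \<subseteq> S"
  shows "nonoverlapping x' y' T a b"
  using assms unfolding nonoverlapping_def disjoint_family_on_def
  by (meson finite_subset order_trans subset_eq)

lemma nonoverlapping_length:
  assumes "nonoverlapping x y S a b" "x \<le> y"
  shows "(\<Sum>i\<in>S. b i - a i) \<le> y - x"
proof -
  have S: "finite S" and ab: "\<And>i. i \<in> S \<Longrightarrow> x \<le> a i \<and> a i \<le> b i \<and> b i \<le> y"
    and disj: "disjoint_family_on (\<lambda>i. {a i<..<b i}) S"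
    using assms(1) by (auto simp: nonoverlapping_def)
  have "(\<Sum>i\<in>S. b i - a i) = (\<Sum>i\<in>S. measure lborel {a i<..<b i})"
    using ab by (intro sum.cong) auto
  also have "\<dots> = measure lborel (\<Union>i\<in>S. {a i<..<b i})"
    using S disj ab by (subst measure_finite_Union) (auto simp: ennreal_less_top[THEN less_imp_neq])
  also have "\<dots> \<le> measure lborel {x..y}"
  proof (rule measure_mono_fmeasurable)
    show "(\<Union>i\<in>S. {a i<..<b i}) \<subseteq> {x..y}"
      using ab by force
    show "(\<Union>i\<in>S. {a i<..<b i}) \<in> sets lborel"
      using S by (intro sets.finite_UN) auto
    show "{x..y} \<in> fmeasurable lborel"
      using fmeasurable_cbox[of x y] by simp
  qed
  finally show ?thesis
    using assms by simp
qed

text \<open>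
  The index type is arbitrary, since families of intervals will also be indexed by pairs: by pairs of indices
  when several families are joined, and by pairs of endpoints.
\<close>

lemma abs_contE:
  assumes "abs_cont f" "\<epsilon> > 0"
  obtains \<delta> where "\<delta> > 0" "\<And>(S::'i set) a b. nonoverlapping 0 1 S a b \<Longrightarrow> (\<Sum>i\<in>S. b i - a i) < \<delta> \<Longrightarrow>
      (\<Sum>i\<in>S. norm (f (b i) - f (a i))) < \<epsilon>"
proof -
  obtain \<delta> where "\<delta> > 0" and \<delta>: "\<And>(S::nat set) a b. nonoverlapping 0 1 S a b \<Longrightarrow> (\<Sum>i\<in>S. b i - a i) < \<delta> \<Longrightarrow>
      (\<Sum>i\<in>S. norm (f (b i) - f (a i))) < \<epsilon>"
    using assms unfolding abs_cont_def by meson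
  have "(\<Sum>i\<in>S. norm (f (b i) - f (a i))) < \<epsilon>"
    if S: "nonoverlapping 0 1 S a b" and less: "(\<Sum>i\<in>S. b i - a i) < \<delta>" for S :: "'i set" and a b
  proof -
    obtain h where h: "bij_betw h {0..<card S} S"
      using S ex_bij_betw_nat_finite unfolding nonoverlapping_def by blast
    show ?thesis
      using \<delta>[OF nonoverlapping_reindex[OF S h]] less sum.reindex_bij_betw[OF h, of "\<lambda>i. b i - a i"]
        sum.reindex_bij_betw[OF h, of "\<lambda>i. norm (f (b i) - f (a i))"] by simp
  qed
  then show ?thesis
    using that \<open>\<delta> > 0\<close> by blast
qed

lemma absolutely_continuous_curve_iff: "absolutely_continuous_curve c \<longleftrightarrow> abs_cont c"
proof
  assume c: "absolutely_continuous_curve c"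
  show "abs_cont c"
    unfolding abs_cont_def
  proof (intro allI impI)
    fix \<epsilon> :: real assume "\<epsilon> > 0"
    then obtain \<delta> where "\<delta> > 0" and \<delta>: "\<And>(m::nat) a b.
        (\<forall>i<m. a i \<in> I01 \<and> b i \<in> I01 \<and> a i < b i) \<Longrightarrow>
        disjoint_family_on (\<lambda>i. {a i<..<b i}) {..<m} \<Longrightarrow>
        (\<Sum>i<m. b i - a i) < \<delta> \<Longrightarrow> (\<Sum>i<m. norm (c (b i) - c (a i))) < \<epsilon>"
      using c unfolding absolutely_continuous_curve_def by meson
    have "(\<Sum>i\<in>S. norm (c (b i) - c (a i))) < \<epsilon>"
      if S: "nonoverlapping 0 1 S a b" and less: "(\<Sum>i\<in>S. b i - a i) < \<delta>" for S :: "nat set" and a b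
    proof -
      \<comment> \<open>Degenerate intervals contribute to neither sum.\<close>
      define S' where "S' = {i\<in>S. a i < b i}"
      have S': "nonoverlapping 0 1 S' a b"
        by (rule nonoverlapping_mono[OF S]) (auto simp: S'_def)
      have fin: "finite S" and le: "\<And>i. i \<in> S \<Longrightarrow> a i \<le> b i"
        using S by (auto simp: nonoverlapping_def)
      have deg: "\<forall>i \<in> S - S'. b i = a i"
        using le by (force simp: S'_def)
      have "S' \<subseteq> S"
        by (auto simp: S'_def)
      have sums: "(\<Sum>i\<in>S. b i - a i) = (\<Sum>i\<in>S'. b i - a i)"
        "(\<Sum>i\<in>S. norm (c (b i) - c (a i))) = (\<Sum>i\<in>S'. norm (c (b i) - c (a i)))"
        by (rule sum.mono_neutral_right[OF fin \<open>S' \<subseteq> S\<close>], use deg in simp)+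
      obtain h where h: "bij_betw h {0..<card S'} S'"
        using S' ex_bij_betw_nat_finite unfolding nonoverlapping_def by blast
      have hS: "h i \<in> S'" if "i < card S'" for i
        using h that by (auto simp: bij_betw_def)
      note reindexed = nonoverlapping_reindex[OF S' h, unfolded nonoverlapping_def]
      have "(\<Sum>i<card S'. norm (c ((b \<circ> h) i) - c ((a \<circ> h) i))) < \<epsilon>"
      proof (rule \<delta>)
        show "\<forall>i<card S'. (a \<circ> h) i \<in> I01 \<and> (b \<circ> h) i \<in> I01 \<and> (a \<circ> h) i < (b \<circ> h) i"
        proof (intro allI impI)
          fix i assume i: "i < card S'"
          then have "0 \<le> a (h i)" "a (h i) < b (h i)" "b (h i) \<le> 1"
            using reindexed hS[OF i] by (auto simp: S'_def)
          then show "(a \<circ> h) i \<in> I01 \<and> (b \<circ> h) i \<in> I01 \<and> (a \<circ> h) i < (b \<circ> h) i"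
            by simp
        qed
        show "disjoint_family_on (\<lambda>i. {(a \<circ> h) i<..<(b \<circ> h) i}) {..<card S'}"
          using reindexed by (simp add: atLeast0LessThan)
        show "(\<Sum>i<card S'. (b \<circ> h) i - (a \<circ> h) i) < \<delta>"
          using less sum.reindex_bij_betw[OF h, of "\<lambda>i. b i - a i"]
          unfolding sums by (simp add: atLeast0LessThan)
      qed
      then show ?thesis
        using sum.reindex_bij_betw[OF h, of "\<lambda>i. norm (c (b i) - c (a i))"]
        unfolding sums by (simp add: atLeast0LessThan)
    qed
    then show "\<exists>\<delta>>0. \<forall>(S::nat set) a b. nonoverlapping 0 1 S a b \<and> (\<Sum>i\<in>S. b i - a i) < \<delta> \<longrightarrow>
        (\<Sum>i\<in>S. norm (c (b i) - c (a i))) < \<epsilon>"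
      using \<open>\<delta> > 0\<close> by blast
  qed
next
  assume c: "abs_cont c"
  show "absolutely_continuous_curve c"
    unfolding absolutely_continuous_curve_def
  proof (intro allI impI)
    fix \<epsilon> :: real assume "\<epsilon> > 0"
    with c obtain \<delta> where "\<delta> > 0" and \<delta>: "\<And>(S::nat set) a b. nonoverlapping 0 1 S a b \<Longrightarrow>
        (\<Sum>i\<in>S. b i - a i) < \<delta> \<Longrightarrow> (\<Sum>i\<in>S. norm (c (b i) - c (a i))) < \<epsilon>"
      by (rule abs_contE) blast
    then show "\<exists>\<delta>>0. \<forall>(m::nat) a b.
        (\<forall>i<m. a i \<in> I01 \<and> b i \<in> I01 \<and> a i < b i) \<and>
        disjoint_family_on (\<lambda>i. {a i<..<b i}) {..<m} \<and>
        (\<Sum>i<m. b i - a i) < \<delta> \<longrightarrow> (\<Sum>i<m. norm (c (b i) - c (a i))) < \<epsilon>"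
    proof (intro exI[of _ \<delta>] conjI allI impI \<open>\<delta> > 0\<close>, elim conjE)
      fix m :: nat and a b
      assume "\<forall>i<m. a i \<in> I01 \<and> b i \<in> I01 \<and> a i < b i" "disjoint_family_on (\<lambda>i. {a i<..<b i}) {..<m}"
      then have "nonoverlapping 0 1 {..<m} a b"
        by (auto simp: nonoverlapping_def less_imp_le)
      moreover assume "(\<Sum>i<m. b i - a i) < \<delta>"
      ultimately show "(\<Sum>i<m. norm (c (b i) - c (a i))) < \<epsilon>"
        by (rule \<delta>)
    qed
  qed
qed

lemma abs_cont_mono:
  assumes "abs_cont f" "\<And>x y. norm (g y - g x) \<le> norm (f y - f x)"
  shows "abs_cont g"
  unfolding abs_cont_def
proof (intro allI impI)
  fix \<epsilon> :: real assume "\<epsilon> > 0"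
  with assms(1) obtain \<delta> where "\<delta> > 0" and \<delta>: "\<And>(S::nat set) a b. nonoverlapping 0 1 S a b \<Longrightarrow>
      (\<Sum>i\<in>S. b i - a i) < \<delta> \<Longrightarrow> (\<Sum>i\<in>S. norm (f (b i) - f (a i))) < \<epsilon>"
    by (rule abs_contE) blast
  show "\<exists>\<delta>>0. \<forall>(S::nat set) a b. nonoverlapping 0 1 S a b \<and> (\<Sum>i\<in>S. b i - a i) < \<delta> \<longrightarrow>
      (\<Sum>i\<in>S. norm (g (b i) - g (a i))) < \<epsilon>"
  proof (intro exI[of _ \<delta>] conjI allI impI \<open>\<delta> > 0\<close>, elim conjE)
    fix S :: "nat set" and a b
    assume "nonoverlapping 0 1 S a b" "(\<Sum>i\<in>S. b i - a i) < \<delta>"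
    then have "(\<Sum>i\<in>S. norm (f (b i) - f (a i))) < \<epsilon>"
      by (rule \<delta>)
    then show "(\<Sum>i\<in>S. norm (g (b i) - g (a i))) < \<epsilon>"
      by (rule le_less_trans[OF sum_mono[OF assms(2)]])
  qed
qed

lemma abs_cont_diff:
  assumes "abs_cont f" "abs_cont g"
  shows "abs_cont (\<lambda>x. f x - g x)"
  unfolding abs_cont_def
proof (intro allI impI)
  fix \<epsilon> :: real assume "\<epsilon> > 0"
  then have "\<epsilon>/2 > 0" by simp
  with assms(1) obtain \<delta>1 where "\<delta>1 > 0" and \<delta>1: "\<And>(S::nat set) a b. nonoverlapping 0 1 S a b \<Longrightarrow>
      (\<Sum>i\<in>S. b i - a i) < \<delta>1 \<Longrightarrow> (\<Sum>i\<in>S. norm (f (b i) - f (a i))) < \<epsilon>/2"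
    by (rule abs_contE) blast
  from assms(2) \<open>\<epsilon>/2 > 0\<close> obtain \<delta>2 where "\<delta>2 > 0" and \<delta>2: "\<And>(S::nat set) a b.
      nonoverlapping 0 1 S a b \<Longrightarrow>
      (\<Sum>i\<in>S. b i - a i) < \<delta>2 \<Longrightarrow> (\<Sum>i\<in>S. norm (g (b i) - g (a i))) < \<epsilon>/2"
    by (rule abs_contE) blast
  show "\<exists>\<delta>>0. \<forall>(S::nat set) a b. nonoverlapping 0 1 S a b \<and> (\<Sum>i\<in>S. b i - a i) < \<delta> \<longrightarrow>
      (\<Sum>i\<in>S. norm ((f (b i) - g (b i)) - (f (a i) - g (a i)))) < \<epsilon>"
  proof (intro exI[of _ "min \<delta>1 \<delta>2"] conjI allI impI, goal_cases)
    case 1 then show ?case using \<open>\<delta>1 > 0\<close> \<open>\<delta>2 > 0\<close> by simp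
  next
    case (2 S a b)
    have "(\<Sum>i\<in>S. norm ((f (b i) - g (b i)) - (f (a i) - g (a i)))) \<le>
        (\<Sum>i\<in>S. norm (f (b i) - f (a i)) + norm (g (b i) - g (a i)))"
    proof (intro sum_mono)
      fix i
      show "norm ((f (b i) - g (b i)) - (f (a i) - g (a i))) \<le> norm (f (b i) - f (a i)) + norm (g (b i) - g (a i))"
        using norm_triangle_ineq4[of "f (b i) - f (a i)" "g (b i) - g (a i)"] by (simp add: algebra_simps)
    qed
    also have "\<dots> < \<epsilon>/2 + \<epsilon>/2"
      unfolding sum.distrib using 2 \<delta>1 \<delta>2 by (intro add_strict_mono) auto
    finally show ?case by simp
  qed
qed

lemma abs_cont_continuous_on:
  assumes "abs_cont f"
  shows "continuous_on {0..1} f"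
  unfolding continuous_on_iff
proof (intro ballI allI impI)
  fix x \<epsilon> :: real assume x: "x \<in> {0..1}" and "\<epsilon> > 0"
  from assms \<open>\<epsilon> > 0\<close> obtain \<delta> where "\<delta> > 0" and \<delta>: "\<And>(S::nat set) a b. nonoverlapping 0 1 S a b \<Longrightarrow>
      (\<Sum>i\<in>S. b i - a i) < \<delta> \<Longrightarrow> (\<Sum>i\<in>S. norm (f (b i) - f (a i))) < \<epsilon>"
    by (rule abs_contE) blast
  have "dist (f y) (f x) < \<epsilon>" if "y \<in> {0..1}" "dist y x < \<delta>" for y
  proof (cases "x \<le> y")
    case True
    then show ?thesis
      using \<delta>[of "{0}" "\<lambda>_. x" "\<lambda>_. y"] x that
      by (auto simp: nonoverlapping_def disjoint_family_on_def dist_norm)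
  next
    case False
    then show ?thesis
      using \<delta>[of "{0}" "\<lambda>_. y" "\<lambda>_. x"] x that
      by (auto simp: nonoverlapping_def disjoint_family_on_def dist_norm norm_minus_commute)
  qed
  then show "\<exists>d>0. \<forall>y\<in>{0..1}. dist y x < d \<longrightarrow> dist (f y) (f x) < \<epsilon>"
    using \<open>\<delta> > 0\<close> by blast
qed

text \<open>
  Every interval is cut at \<open>y\<close>; an interval that does not contain \<open>y\<close> leaves a degenerate one on the other side.
\<close>

lemma nonoverlapping_split:
  assumes "nonoverlapping x z S a b" "x \<le> y" "y \<le> z"
  shows "nonoverlapping x y S (\<lambda>i. min y (a i)) (\<lambda>i. min y (b i))"
    and "nonoverlapping y z S (\<lambda>i. max y (a i)) (\<lambda>i. max y (b i))"
    and "(\<Sum>i\<in>S. norm (f (b i) - f (a i))) \<le>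
      (\<Sum>i\<in>S. norm (f (min y (b i)) - f (min y (a i)))) + (\<Sum>i\<in>S. norm (f (max y (b i)) - f (max y (a i))))"
proof -
  have disj: "disjoint_family_on (\<lambda>i. {a i<..<b i}) S" and ab: "\<And>i. i \<in> S \<Longrightarrow> a i \<le> b i"
    using assms by (auto simp: nonoverlapping_def)
  have "disjoint_family_on (\<lambda>i. {min y (a i)<..<min y (b i)}) S"
       "disjoint_family_on (\<lambda>i. {max y (a i)<..<max y (b i)}) S"
    using disj by (rule disjoint_family_on_bisimulation; force)+
  then show "nonoverlapping x y S (\<lambda>i. min y (a i)) (\<lambda>i. min y (b i))"
    and "nonoverlapping y z S (\<lambda>i. max y (a i)) (\<lambda>i. max y (b i))"
    using assms by (auto simp: nonoverlapping_def)
  have "norm (f (b i) - f (a i)) \<le>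
      norm (f (min y (b i)) - f (min y (a i))) + norm (f (max y (b i)) - f (max y (a i)))"
    if "i \<in> S" for i
    using ab[OF that] norm_triangle_ineq[of "f y - f (a i)" "f (b i) - f y"]
    by (auto simp: min_def max_def)
  then show "(\<Sum>i\<in>S. norm (f (b i) - f (a i))) \<le>
      (\<Sum>i\<in>S. norm (f (min y (b i)) - f (min y (a i)))) + (\<Sum>i\<in>S. norm (f (max y (b i)) - f (max y (a i))))"
    unfolding sum.distrib[symmetric] by (rule sum_mono)
qed

section \<open>Total variation\<close>

definition variation_sums :: "(real \<Rightarrow> 'a::real_normed_vector) \<Rightarrow> real \<Rightarrow> real set" where
  "variation_sums f x = {\<Sum>i\<in>S. norm (f (b i) - f (a i)) | (S::nat set) a b. nonoverlapping 0 x S a b}"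

definition variation :: "(real \<Rightarrow> 'a::real_normed_vector) \<Rightarrow> real \<Rightarrow> real" where
  "variation f x = Sup (variation_sums f x)"

lemma zero_in_variation_sums: "0 \<in> variation_sums f x"
  unfolding variation_sums_def
  by (rule CollectI, intro exI[of _ "{}"] exI[of _ "\<lambda>_. 0"]) (simp add: nonoverlapping_def disjoint_family_on_def)

text \<open>
  Absolute continuity bounds the sums over a sufficiently short interval by \<open>1\<close>. Cutting at the multiples of
  \<open>1 / (N + 1)\<close> therefore bounds all sums by \<open>N + 1\<close>.
\<close>

lemma bdd_above_variation_sums:
  assumes "abs_cont f" "x \<le> 1"
  shows "bdd_above (variation_sums f x)"
proof -
  obtain \<delta> where "\<delta> > 0" and \<delta>: "\<And>(S::nat set) a b. nonoverlapping 0 1 S a b \<Longrightarrow>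
      (\<Sum>i\<in>S. b i - a i) < \<delta> \<Longrightarrow> (\<Sum>i\<in>S. norm (f (b i) - f (a i))) < 1"
    using abs_contE[OF assms(1) zero_less_one] by blast
  obtain N where N: "inverse (real (Suc N)) < \<delta>"
    using \<open>\<delta> > 0\<close> reals_Archimedean by blast
  have "(\<Sum>i\<in>S. norm (f (b i) - f (a i))) \<le> n"
    if "nonoverlapping 0 (n / Suc N) S a b" "n \<le> Suc N" for n and S :: "nat set" and a b
    using that
  proof (induction n arbitrary: a b)
    case 0
    then have "a i = 0 \<and> b i = 0" if "i \<in> S" for i
      using that unfolding nonoverlapping_def by fastforce
    then show ?case by simp
  next
    case (Suc n)
    have le: "0 \<le> n / Suc N" "n / Suc N \<le> Suc n / Suc N"
      by (auto simp: divide_right_mono)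
    note sp = nonoverlapping_split[OF Suc.prems(1) le]
    have "(\<Sum>i\<in>S. max (n / Suc N) (b i) - max (n / Suc N) (a i)) \<le> Suc n / Suc N - n / Suc N"
      by (rule nonoverlapping_length[OF sp(2) le(2)])
    also have "\<dots> = inverse (real (Suc N))"
      by (simp add: field_simps)
    also note N
    finally have "(\<Sum>i\<in>S. norm (f (max (n / Suc N) (b i)) - f (max (n / Suc N) (a i)))) < 1"
      using Suc.prems(2) by (intro \<delta> nonoverlapping_mono[OF sp(2)]) (auto simp: field_simps)
    moreover have "(\<Sum>i\<in>S. norm (f (min (n / Suc N) (b i)) - f (min (n / Suc N) (a i)))) \<le> n"
      using Suc.prems(2) by (intro Suc.IH sp(1)) auto
    ultimately show ?case
      using sp(3)[of f] by simp
  qed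
  note bound = this[of "Suc N"]
  have "s \<le> Suc N" if s: "s \<in> variation_sums f x" for s
  proof -
    obtain S :: "nat set" and a b where S: "nonoverlapping 0 x S a b" and eq: "s = (\<Sum>i\<in>S. norm (f (b i) - f (a i)))"
      using s by (auto simp: variation_sums_def)
    have "nonoverlapping 0 (Suc N / Suc N) S a b"
      using nonoverlapping_mono[OF S, of 0 1 S] assms by simp
    from bound[OF this] show ?thesis
      by (simp add: eq)
  qed
  then show ?thesis
    by (rule bdd_aboveI)
qed

text \<open>
  A family in \<open>[0,x]\<close> can be enlarged by the interval from \<open>x\<close> to \<open>y\<close>. The inequality makes both the
  variation and, for real \<open>f\<close>, the variation minus \<open>f\<close> monotone.
\<close>

lemma norm_diff_le_variation_diff:
  assumes "abs_cont f" "0 \<le> x" "x \<le> y" "y \<le> 1"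
  shows "norm (f y - f x) \<le> variation f y - variation f x"
proof -
  have "s + norm (f y - f x) \<le> variation f y" if s: "s \<in> variation_sums f x" for s
  proof -
    obtain S :: "nat set" and a b where S: "nonoverlapping 0 x S a b" and eq: "s = (\<Sum>i\<in>S. norm (f (b i) - f (a i)))"
      using s by (auto simp: variation_sums_def)
    have "finite S"
      using S by (simp add: nonoverlapping_def)
    define n where "n = (SOME n. n \<notin> S)"
    have n: "n \<notin> S"
      unfolding n_def using ex_new_if_finite[OF infinite_UNIV_nat \<open>finite S\<close>] by (rule someI_ex)
    have "nonoverlapping 0 y (insert n S) (a(n := x)) (b(n := y))"
      unfolding nonoverlapping_def
    proof (intro conjI ballI)
      show "finite (insert n S)"
        using \<open>finite S\<close> by simp
      show "disjoint_family_on (\<lambda>i. {(a(n := x)) i<..<(b(n := y)) i}) (insert n S)"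
        unfolding disjoint_family_on_insert[OF n]
      proof
        have "{(a(n := x)) n<..<(b(n := y)) n} \<inter> {(a(n := x)) i<..<(b(n := y)) i} = {}" if "i \<in> S" for i
        proof -
          have "b i \<le> x" "i \<noteq> n"
            using S that n by (auto simp: nonoverlapping_def)
          then show ?thesis by auto
        qed
        then show "{(a(n := x)) n<..<(b(n := y)) n} \<inter> (\<Union>i\<in>S. {(a(n := x)) i<..<(b(n := y)) i}) = {}"
          by blast
        show "disjoint_family_on (\<lambda>i. {(a(n := x)) i<..<(b(n := y)) i}) S"
          using S n unfolding nonoverlapping_def disjoint_family_on_def by auto
      qed
    qed (use S n assms in \<open>auto simp: nonoverlapping_def\<close>)
    moreover have "(\<Sum>i\<in>insert n S. norm (f ((b(n := y)) i) - f ((a(n := x)) i))) = s + norm (f y - f x)"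
    proof -
      have "(\<Sum>i\<in>S. norm (f ((b(n := y)) i) - f ((a(n := x)) i))) = s"
        unfolding eq using n by (intro sum.cong) auto
      then show ?thesis
        using n \<open>finite S\<close> by simp
    qed
    ultimately have "s + norm (f y - f x) \<in> variation_sums f y"
      unfolding variation_sums_def
      by (intro CollectI exI[of _ "insert n S"] exI[of _ "a(n := x)"] exI[of _ "b(n := y)"] conjI) simp_all
    then show ?thesis
      unfolding variation_def by (intro cSup_upper bdd_above_variation_sums assms)
  qed
  then have "variation f x \<le> variation f y - norm (f y - f x)"
    unfolding variation_def[of f x] using zero_in_variation_sums
    by (intro cSup_least) (auto simp: algebra_simps)
  then show ?thesis by simp
qed

text \<open>
  An almost optimal family in \<open>[0, y i]\<close> is cut at \<open>x i\<close>. Its left part contributes at most the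
  variation at \<open>x i\<close>, so the increment of the variation is controlled by the right parts, and for all \<open>i\<close>
  together these form one nonoverlapping family of small total length.
\<close>

lemma abs_cont_variation:
  assumes "abs_cont f"
  shows "abs_cont (variation f)"
  unfolding abs_cont_def
proof (intro allI impI)
  fix \<epsilon> :: real assume "\<epsilon> > 0"
  then have "\<epsilon>/2 > 0" by simp
  with assms obtain \<delta> where "\<delta> > 0" and \<delta>: "\<And>(S::(nat \<times> nat) set) a b. nonoverlapping 0 1 S a b \<Longrightarrow>
      (\<Sum>i\<in>S. b i - a i) < \<delta> \<Longrightarrow> (\<Sum>i\<in>S. norm (f (b i) - f (a i))) < \<epsilon>/2"
    by (rule abs_contE) blast
  show "\<exists>\<delta>>0. \<forall>(S::nat set) a b. nonoverlapping 0 1 S a b \<and> (\<Sum>i\<in>S. b i - a i) < \<delta> \<longrightarrow>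
      (\<Sum>i\<in>S. norm (variation f (b i) - variation f (a i))) < \<epsilon>"
  proof (intro exI[of _ \<delta>] conjI allI impI \<open>\<delta> > 0\<close>, elim conjE)
    fix S :: "nat set" and x y
    assume S: "nonoverlapping 0 1 S x y" and less: "(\<Sum>i\<in>S. y i - x i) < \<delta>"
    then have fin: "finite S" and xy: "\<And>i. i \<in> S \<Longrightarrow> 0 \<le> x i \<and> x i \<le> y i \<and> y i \<le> 1"
      and disj: "disjoint_family_on (\<lambda>i. {x i<..<y i}) S"
      by (auto simp: nonoverlapping_def)
    define \<eta> where "\<eta> = \<epsilon> / 2 / (real (card S) + 1)"
    have "\<eta> > 0"
      using \<open>\<epsilon> > 0\<close> by (simp add: \<eta>_def)
    have "\<exists>(T::nat set) a b. nonoverlapping 0 (y i) T a b \<and>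
        variation f (y i) - \<eta> < (\<Sum>j\<in>T. norm (f (b j) - f (a j)))" if "i \<in> S" for i
    proof -
      have "\<exists>s\<in>variation_sums f (y i). variation f (y i) - \<eta> < s"
        unfolding variation_def using \<open>\<eta> > 0\<close> zero_in_variation_sums
        by (intro less_cSupD) auto
      then show ?thesis
        unfolding variation_sums_def by blast
    qed
    then obtain T :: "nat \<Rightarrow> nat set" and a b where T: "\<And>i. i \<in> S \<Longrightarrow> nonoverlapping 0 (y i) (T i) (a i) (b i)"
      and approx: "\<And>i. i \<in> S \<Longrightarrow> variation f (y i) - \<eta> < (\<Sum>j\<in>T i. norm (f (b i j) - f (a i j)))"
      by metis
    define A where "A = (\<lambda>(i,j). max (x i) (a i j))"
    define B where "B = (\<lambda>(i,j). max (x i) (b i j))"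
    have right: "nonoverlapping (x i) (y i) (T i) (\<lambda>j. A (i,j)) (\<lambda>j. B (i,j))" if "i \<in> S" for i
      using nonoverlapping_split(2)[OF T[OF that]] xy[OF that] by (simp add: A_def B_def)
    have incr: "norm (variation f (y i) - variation f (x i)) \<le>
        \<eta> + (\<Sum>j\<in>T i. norm (f (B (i,j)) - f (A (i,j))))" if "i \<in> S" for i
    proof -
      have le: "0 \<le> x i" "x i \<le> y i" "y i \<le> 1"
        using xy that by auto
      have "(\<Sum>j\<in>T i. norm (f (min (x i) (b i j)) - f (min (x i) (a i j)))) \<in> variation_sums f (x i)"
        unfolding variation_sums_def using nonoverlapping_split(1)[OF T[OF that] le(1,2)]
        by (intro CollectI exI conjI) (rule refl)
      then have "(\<Sum>j\<in>T i. norm (f (min (x i) (b i j)) - f (min (x i) (a i j)))) \<le> variation f (x i)"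
        unfolding variation_def using assms le by (intro cSup_upper bdd_above_variation_sums) auto
      then have "variation f (y i) - variation f (x i) \<le> \<eta> + (\<Sum>j\<in>T i. norm (f (B (i,j)) - f (A (i,j))))"
        using approx[OF that] nonoverlapping_split(3)[OF T[OF that] le(1,2), of f]
        by (simp add: A_def B_def)
      moreover have "variation f (x i) \<le> variation f (y i)"
        using norm_diff_le_variation_diff[OF assms le] norm_ge_zero[of "f (y i) - f (x i)"] by linarith
      ultimately show ?thesis by simp
    qed
    have finT: "\<And>i. i \<in> S \<Longrightarrow> finite (T i)"
      using T by (auto simp: nonoverlapping_def)
    have "nonoverlapping 0 1 (Sigma S T) A B"
      unfolding nonoverlapping_def
    proof (intro conjI ballI)
      show "finite (Sigma S T)"
        using fin finT by auto
    next
      fix p assume "p \<in> Sigma S T"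
      then obtain i j where p: "p = (i,j)" "i \<in> S" "j \<in> T i" by blast
      then have "x i \<le> A p \<and> A p \<le> B p \<and> B p \<le> y i"
        using right[of i] by (auto simp: nonoverlapping_def)
      then show "0 \<le> A p" "A p \<le> B p" "B p \<le> 1"
        using xy p by fastforce+
    next
      show "disjoint_family_on (\<lambda>p. {A p<..<B p}) (Sigma S T)"
        unfolding disjoint_family_on_def
      proof (intro ballI impI)
        fix p q assume pq: "p \<in> Sigma S T" "q \<in> Sigma S T" "p \<noteq> q"
        obtain i j k l where ij: "p = (i,j)" "i \<in> S" "j \<in> T i" and kl: "q = (k,l)" "k \<in> S" "l \<in> T k"
          using pq by blast
        show "{A p<..<B p} \<inter> {A q<..<B q} = {}"
        proof (cases "i = k")
          case True
          then show ?thesis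
            using right[of i] ij kl pq unfolding nonoverlapping_def disjoint_family_on_def by auto
        next
          case False
          have "{A p<..<B p} \<subseteq> {x i<..<y i}" "{A q<..<B q} \<subseteq> {x k<..<y k}"
            using right[of i] right[of k] ij kl unfolding nonoverlapping_def by fastforce+
          moreover have "{x i<..<y i} \<inter> {x k<..<y k} = {}"
            using disj False ij kl by (auto simp: disjoint_family_on_def)
          ultimately show ?thesis by blast
        qed
      qed
    qed
    moreover have "(\<Sum>p\<in>Sigma S T. B p - A p) < \<delta>"
    proof -
      have "(\<Sum>p\<in>Sigma S T. B p - A p) = (\<Sum>i\<in>S. \<Sum>j\<in>T i. B (i,j) - A (i,j))"
        using fin finT by (subst sum.Sigma) (auto simp: case_prod_beta)
      also have "\<dots> \<le> (\<Sum>i\<in>S. y i - x i)"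
        using xy by (intro sum_mono nonoverlapping_length right) auto
      finally show ?thesis using less by simp
    qed
    ultimately have "(\<Sum>p\<in>Sigma S T. norm (f (B p) - f (A p))) < \<epsilon>/2"
      by (rule \<delta>)
    moreover have "(\<Sum>p\<in>Sigma S T. norm (f (B p) - f (A p))) = (\<Sum>i\<in>S. \<Sum>j\<in>T i. norm (f (B (i,j)) - f (A (i,j))))"
      using fin finT by (subst sum.Sigma) (auto simp: case_prod_beta)
    moreover have "(\<Sum>i\<in>S. norm (variation f (y i) - variation f (x i))) \<le>
        (\<Sum>i\<in>S. \<eta> + (\<Sum>j\<in>T i. norm (f (B (i,j)) - f (A (i,j)))))"
      by (rule sum_mono[OF incr])
    moreover have "real (card S) * \<eta> \<le> \<epsilon>/2"
      using \<open>\<epsilon> > 0\<close> by (simp add: \<eta>_def field_simps)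
    ultimately show "(\<Sum>i\<in>S. norm (variation f (y i) - variation f (x i))) < \<epsilon>"
      by (simp add: sum.distrib)
  qed
qed

section \<open>Absolutely continuous functions are indefinite integrals\<close>

text \<open>
  An interval is represented by the pair of its endpoints, so that any finite part of the cover is a
  nonoverlapping family indexed by itself.
\<close>

lemma open_unit_interval_decomposition:
  fixes S U :: "real set"
  assumes "open U" "S \<subseteq> U" "S \<subseteq> {0..1}"
  obtains C :: "(real \<times> real) set" where "countable C" "S \<subseteq> (\<Union>p\<in>C. {fst p..snd p})"
    "\<forall>p\<in>C. {fst p..snd p} \<subseteq> U"
    "\<forall>F\<subseteq>C. finite F \<longrightarrow> nonoverlapping 0 1 F fst snd"
proof -
  \<comment> \<open>The tags of the cover lie in \<open>S\<close>, so \<open>\<gamma>\<close> forces each interval into \<open>U\<close>. The value off \<open>U\<close> only serves to make \<open>\<gamma>\<close> a gauge.\<close>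
  define \<gamma> where "\<gamma> = (\<lambda>x. if x \<in> U then U else UNIV)"
  have \<gamma>: "gauge \<gamma>"
    using \<open>open U\<close> by (auto simp: gauge_def \<gamma>_def)
  have sub: "S \<subseteq> cbox 0 1" and ne: "box 0 (1::real) \<noteq> {}"
    using assms by auto
  have "\<exists>\<D>. countable \<D> \<and> \<Union>\<D> \<subseteq> {0..1} \<and>
    (\<forall>K\<in>\<D>. interior K \<noteq> {} \<and> (\<exists>c d. K = {c..d})) \<and>
    pairwise (\<lambda>A B. interior A \<inter> interior B = {}) \<D> \<and>
    (\<forall>K\<in>\<D>. \<exists>x \<in> S \<inter> K. K \<subseteq> \<gamma> x) \<and> S \<subseteq> \<Union>\<D>"
    apply (rule covering_lemma[OF sub ne \<gamma>])
    apply (rename_tac \<D>, rule_tac x=\<D> in exI)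
    apply (intro conjI ballI; (assumption | simp | blast))
    done
  then obtain \<D> where \<D>: "countable \<D>" "\<Union>\<D> \<subseteq> {0..1}"
    and ints: "\<forall>K\<in>\<D>. interior K \<noteq> {} \<and> (\<exists>c d. K = {c..d})"
    and pw: "pairwise (\<lambda>A B. interior A \<inter> interior B = {}) \<D>"
    and tag: "\<forall>K\<in>\<D>. \<exists>x \<in> S \<inter> K. K \<subseteq> \<gamma> x"
    and cov: "S \<subseteq> \<Union>\<D>"
    by (elim exE conjE)
  define C where "C = {p. fst p < snd p \<and> {fst p..snd p} \<in> \<D>}"
  have C: "fst p < snd p" "{fst p..snd p} \<in> \<D>" if "p \<in> C" for p
    using that by (auto simp: C_def)
  show ?thesis
  proof
    have "p \<in> (\<lambda>K. (Inf K, Sup K)) ` \<D>" if "p \<in> C" for p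
    proof
      show "p = (Inf {fst p..snd p}, Sup {fst p..snd p})"
        using C(1)[OF that] by simp
      show "{fst p..snd p} \<in> \<D>"
        by (rule C(2)[OF that])
    qed
    then have "C \<subseteq> (\<lambda>K. (Inf K, Sup K)) ` \<D>"
      by (rule subsetI)
    then show "countable C"
      using \<D>(1) countable_subset countable_image by metis
    show "S \<subseteq> (\<Union>p\<in>C. {fst p..snd p})"
    proof
      fix x assume "x \<in> S"
      then obtain K where K: "K \<in> \<D>" "x \<in> K"
        using cov by (meson UnionE subsetD)
      obtain c d where cd: "K = {c..d}"
        using ints K(1) by meson
      have "interior {c..d} \<noteq> {}"
        using bspec[OF ints K(1)] unfolding cd by (rule conjunct1)
      then have "c < d"
        by (simp add: interior_atLeastAtMost_real)
      then have "(c,d) \<in> C"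
        using K(1) by (simp add: C_def cd)
      then show "x \<in> (\<Union>p\<in>C. {fst p..snd p})"
        using K(2) unfolding cd by (intro UN_I[of "(c,d)"]) simp_all
    qed
    show "\<forall>p\<in>C. {fst p..snd p} \<subseteq> U"
    proof
      fix p assume p: "p \<in> C"
      obtain x where "x \<in> S" and *: "{fst p..snd p} \<subseteq> \<gamma> x"
        using tag C(2)[OF p] by (meson IntD1)
      then have "x \<in> U"
        using assms(2) by (rule_tac subsetD)
      then show "{fst p..snd p} \<subseteq> U"
        using * by (simp add: \<gamma>_def)
    qed
    show "\<forall>F\<subseteq>C. finite F \<longrightarrow> nonoverlapping 0 1 F fst snd"
      unfolding nonoverlapping_def
    proof (intro allI impI conjI ballI)
      fix F assume F: "F \<subseteq> C" "finite F"
      show "finite F" by fact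
      show "0 \<le> fst p" "fst p \<le> snd p" "snd p \<le> 1" if "p \<in> F" for p
      proof -
        have p: "p \<in> C" using that F(1) by (rule_tac subsetD)
        have "{fst p..snd p} \<subseteq> {0..1}"
          using \<D>(2) C(2)[OF p] by (meson Union_upper subset_trans)
        then show "0 \<le> fst p" "fst p \<le> snd p" "snd p \<le> 1"
          using C(1)[OF p] by simp_all
      qed
      show "disjoint_family_on (\<lambda>p. {fst p<..<snd p}) F"
        unfolding disjoint_family_on_def
      proof (intro ballI impI)
        fix p q assume pq: "p \<in> F" "q \<in> F" "p \<noteq> q"
        then have Cpq: "p \<in> C" "q \<in> C"
          using F(1) by (meson subsetD)+
        have "{fst p..snd p} \<noteq> {fst q..snd q}"
          using pq(3) C(1)[OF Cpq(1)] by (simp add: Icc_eq_Icc prod_eq_iff)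
        then have "interior {fst p..snd p} \<inter> interior {fst q..snd q} = {}"
          using pw C(2)[OF Cpq(1)] C(2)[OF Cpq(2)] by (meson pairwiseD)
        then show "{fst p<..<snd p} \<inter> {fst q<..<snd q} = {}"
          by (simp add: interior_atLeastAtMost_real)
      qed
    qed
  qed
qed

text \<open>
  The density is the Radon-Nikodym derivative of the Stieltjes measure of \<open>T\<close>. Absolute continuity of the
  measure follows from that of \<open>T\<close>: a null set lies in an open set of measure less than \<open>\<delta>\<close>, and the part
  of the null set in the unit interval is covered by nonoverlapping intervals inside this open set, over
  which \<open>T\<close> increases by less than \<open>\<epsilon>\<close> in total.
\<close>

lemma monotone_abs_cont_density:
  fixes T :: "real \<Rightarrow> real"
  assumes T: "abs_cont T" and mono: "\<And>x y. 0 \<le> x \<Longrightarrow> x \<le> y \<Longrightarrow> y \<le> 1 \<Longrightarrow> T x \<le> T y"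
  obtains f :: "real \<Rightarrow> real" where "f absolutely_integrable_on {0..1}"
    "\<forall>x\<in>{0..1}. T x - T 0 = integral {0..x} f"
proof -
  \<comment> \<open>\<open>T\<close> is extended to the line by its boundary values, since a Stieltjes measure needs a monotone function on the line.\<close>
  define cl where "cl = (\<lambda>x::real. max 0 (min 1 x))"
  define F where "F = (\<lambda>x. T (cl x))"
  have F_mono: "F x \<le> F y" if "x \<le> y" for x y
    unfolding F_def cl_def using that by (intro mono) auto
  have F_cont: "continuous_on UNIV F"
    unfolding F_def cl_def
    by (rule continuous_on_compose2[OF abs_cont_continuous_on[OF T]]) (auto intro!: continuous_intros)
  define M where "M = interval_measure F"
  have M_Icc: "emeasure M {a..b} = ennreal (F b - F a)" if "a \<le> b" for a b
    unfolding M_def using F_mono F_cont that by (intro emeasure_interval_measure_Icc) auto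
  define N where "N = density M (indicator {0..1})"
  have [measurable_cong, simp]: "sets M = sets borel" "sets N = sets borel"
    by (auto simp: M_def N_def)
  have [simp]: "space M = UNIV" "space N = UNIV"
    by (auto simp: M_def N_def)
  have N_eq: "emeasure N A = emeasure M ({0..1} \<inter> A)" if "A \<in> sets borel" for A
  proof -
    have "emeasure N A = (\<integral>\<^sup>+x. indicator {0..1} x * indicator A x \<partial>M)"
      unfolding N_def using that by (intro emeasure_density) auto
    also have "\<dots> = (\<integral>\<^sup>+x. indicator ({0..1} \<inter> A) x \<partial>M)"
      by (simp add: indicator_inter_arith)
    also have "\<dots> = emeasure M ({0..1} \<inter> A)"
      using that by (intro nn_integral_indicator) auto
    finally show ?thesis .
  qed
  have fin: "finite_measure N"
    by (rule finite_measureI) (use N_eq[of UNIV] M_Icc[of 0 1] in auto)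
  have ac: "absolutely_continuous lborel N"
    unfolding absolutely_continuous_def
  proof
    fix Z assume Z: "Z \<in> null_sets (lborel::real measure)"
    then have [measurable]: "Z \<in> sets borel" by auto
    have small: "emeasure M ({0..1} \<inter> Z) \<le> ennreal \<epsilon>" if "\<epsilon> > 0" for \<epsilon>
    proof -
      obtain \<delta> where "\<delta> > 0" and \<delta>: "\<And>(S::(real \<times> real) set) a b. nonoverlapping 0 1 S a b \<Longrightarrow>
          (\<Sum>i\<in>S. b i - a i) < \<delta> \<Longrightarrow> (\<Sum>i\<in>S. norm (T (b i) - T (a i))) < \<epsilon>"
        using abs_contE[OF T \<open>\<epsilon> > 0\<close>] by blast
      have Zl: "Z \<in> null_sets lebesgue"
        using Z by (simp add: null_sets_completionI)
      then obtain U where U: "open U" "Z \<subseteq> U" "(U - Z) \<in> lmeasurable" "emeasure lebesgue (U - Z) < ennreal \<delta>"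
        using sets_lebesgue_outer_open[OF _ \<open>\<delta> > 0\<close>] by (metis null_setsD2)
      have UZ: "emeasure lebesgue U < ennreal \<delta>"
        using U(4) Zl U(1) by (simp add: emeasure_Diff_null_set)
      obtain C :: "(real \<times> real) set" where C: "countable C" "Z \<inter> {0..1} \<subseteq> (\<Union>p\<in>C. {fst p..snd p})"
        and CU': "\<forall>p\<in>C. {fst p..snd p} \<subseteq> U"
        and no': "\<forall>F\<subseteq>C. finite F \<longrightarrow> nonoverlapping 0 1 F fst snd"
      proof (rule open_unit_interval_decomposition[OF U(1)])
        show "Z \<inter> {0..1} \<subseteq> U" "Z \<inter> {0..1} \<subseteq> {0..1}"
          using U(2) by auto
      qed (rule that)
      note CU = CU'[rule_format] and no = no'[rule_format]
      have p01: "0 \<le> fst p \<and> fst p \<le> snd p \<and> snd p \<le> 1" if "p \<in> C" for p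
        using no[of "{p}"] that by (simp add: nonoverlapping_def)
      have M_p: "emeasure M {fst p..snd p} = ennreal (norm (T (snd p) - T (fst p)))" if "p \<in> C" for p
        using p01[OF that] mono[of "fst p" "snd p"] by (simp add: M_Icc F_def cl_def)
      have meas: "{fst p..snd p} \<in> fmeasurable M" if "p \<in> C" for p
        by (rule fmeasurableI) (simp_all add: M_p that)
      have part: "measure M (\<Union>p\<in>F. {fst p..snd p}) \<le> \<epsilon>" if F: "F \<subseteq> C" "finite F" for F
      proof -
        have "ennreal (\<Sum>p\<in>F. snd p - fst p) = (\<Sum>p\<in>F. emeasure lebesgue {fst p<..<snd p})"
        proof -
          have "(\<Sum>p\<in>F. emeasure lebesgue {fst p<..<snd p}) = (\<Sum>p\<in>F. ennreal (snd p - fst p))"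
            using p01 subsetD[OF F(1)] by (intro sum.cong) simp_all
          also have "\<dots> = ennreal (\<Sum>p\<in>F. snd p - fst p)"
            using p01 subsetD[OF F(1)] by (intro sum_ennreal) simp
          finally show ?thesis by (rule sym)
        qed
        also have "\<dots> = emeasure lebesgue (\<Union>p\<in>F. {fst p<..<snd p})"
          using no[OF F] by (intro sum_emeasure) (auto simp: nonoverlapping_def)
        also have "\<dots> \<le> emeasure lebesgue U"
        proof (rule emeasure_mono)
          show "(\<Union>p\<in>F. {fst p<..<snd p}) \<subseteq> U"
          proof (rule UN_least)
            fix p assume "p \<in> F"
            have "{fst p<..<snd p} \<subseteq> {fst p..snd p}"
              by auto
            also have "\<dots> \<subseteq> U"
              using \<open>p \<in> F\<close> F(1) by (intro CU) (rule subsetD)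
            finally show "{fst p<..<snd p} \<subseteq> U" .
          qed
        qed (use U(1) in simp)
        also note UZ
        finally have "(\<Sum>p\<in>F. snd p - fst p) < \<delta>"
          using ennreal_leI[of \<delta> "\<Sum>p\<in>F. snd p - fst p"] by (meson not_le)
        then have "(\<Sum>p\<in>F. norm (T (snd p) - T (fst p))) < \<epsilon>"
          using \<delta>[OF no[OF F]] by simp
        moreover have "(\<Sum>p\<in>F. measure M {fst p..snd p}) = (\<Sum>p\<in>F. norm (T (snd p) - T (fst p)))"
          using F(1) M_p by (intro sum.cong) (auto simp: measure_def)
        moreover have "measure M (\<Union>p\<in>F. {fst p..snd p}) \<le> (\<Sum>p\<in>F. measure M {fst p..snd p})"
          using F meas by (intro measure_UNION_le) auto
        ultimately show ?thesis by simp
      qed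
      have "emeasure M ({0..1} \<inter> Z) \<le> emeasure M (\<Union>p\<in>C. {fst p..snd p})"
        using C by (intro emeasure_mono sets.countable_UN') auto
      also have "\<dots> = ennreal (measure M (\<Union>p\<in>C. {fst p..snd p}))"
        using fmeasurable_UN_bound[OF C(1) meas part] by (simp add: emeasure_eq_measure2)
      also have "\<dots> \<le> ennreal \<epsilon>"
        using measure_UN_bound[OF C(1) meas part] by (rule ennreal_leI)
      finally show ?thesis .
    qed
    have "emeasure M ({0..1} \<inter> Z) \<le> 0"
    proof (rule ennreal_le_epsilon)
      fix e :: real assume "0 < e"
      then show "emeasure M ({0..1} \<inter> Z) \<le> 0 + ennreal e"
        using small[of e] by simp
    qed
    then show "Z \<in> null_sets N"
      using N_eq[of Z] by (auto simp: null_sets_def)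
  qed
  obtain g where g[measurable]: "g \<in> borel_measurable lborel" and gN: "density lborel g = N"
    using sigma_finite_measure.Radon_Nikodym[OF lborel.sigma_finite_measure_axioms ac] by auto
  have g_int: "(\<integral>\<^sup>+t. g t * indicator {0..x} t \<partial>lborel) = ennreal (T x - T 0)" if "x \<in> {0..1}" for x
  proof -
    have "(\<integral>\<^sup>+t. g t * indicator {0..x} t \<partial>lborel) = emeasure N {0..x}"
      using gN by (subst emeasure_density[symmetric]) auto
    also have "\<dots> = emeasure M {0..x}"
      using that by (subst N_eq) (auto intro!: arg_cong[where f = "emeasure M"])
    also have "\<dots> = ennreal (T x - T 0)"
      using that by (subst M_Icc) (auto simp: F_def cl_def)
    finally show ?thesis .
  qed
  have g_fin: "AE t in lborel. g t * indicator {0..1} t \<noteq> \<infinity>"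
    by (rule nn_integral_PInf_AE) (use g_int[of 1] in auto)
  \<comment> \<open>The density is finite almost everywhere on the unit interval, so that passing to real values does not change its integrals there.\<close>
  define f where "f = (\<lambda>t. enn2real (g t))"
  have f_int: "(\<integral>\<^sup>+t. ennreal (indicator {0..x} t * f t) \<partial>lborel) = ennreal (T x - T 0)" if "x \<in> {0..1}" for x
    unfolding g_int[OF that, symmetric]
  proof (rule nn_integral_cong_AE)
    show "AE t in lborel. ennreal (indicator {0..x} t * f t) = g t * indicator {0..x} t"
      using g_fin by eventually_elim (use that in \<open>auto simp: f_def indicator_def top.not_eq_extremum split: if_splits\<close>)
  qed
  have hi: "(f has_integral (T x - T 0)) {0..x}" if "x \<in> {0..1}" for x
  proof -
    have "((\<lambda>t. indicator {0..x} t * f t) has_integral (T x - T 0)) UNIV"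
      using f_int[OF that] mono[of 0 x] that by (intro nn_integral_has_integral) (auto simp: f_def)
    moreover have "(\<lambda>t. indicator {0..x} t * f t) = (\<lambda>t. if t \<in> {0..x} then f t else 0)"
      by (auto simp: indicator_def)
    ultimately show ?thesis
      using has_integral_restrict_UNIV[of "{0..x}" f] by metis
  qed
  show ?thesis
  proof
    show "f absolutely_integrable_on {0..1}"
      using hi[of 1] by (intro nonnegative_absolutely_integrable_1) (auto simp: f_def)
    show "\<forall>x\<in>{0..1}. T x - T 0 = integral {0..x} f"
      by (intro ballI) (rule integral_unique[OF hi, symmetric])
  qed
qed

text \<open>
  The Jordan decomposition \<open>f = variation f - (variation f - f)\<close> reduces the claim to monotone functions.
\<close>

lemma abs_cont_real_eq_integral:
  fixes f :: "real \<Rightarrow> real"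
  assumes f: "abs_cont f"
  obtains g where "g absolutely_integrable_on {0..1}" "\<forall>x\<in>{0..1}. f x - f 0 = integral {0..x} g"
proof -
  have mono: "\<bar>f y - f x\<bar> \<le> variation f y - variation f x" if "0 \<le> x" "x \<le> y" "y \<le> 1" for x y
    using norm_diff_le_variation_diff[OF f that] by simp
  obtain p where p: "p absolutely_integrable_on {0..1}"
      "\<forall>x\<in>{0..1}. variation f x - variation f 0 = integral {0..x} p"
  proof (rule monotone_abs_cont_density[OF abs_cont_variation[OF f]])
    show "variation f x \<le> variation f y" if "0 \<le> x" "x \<le> y" "y \<le> 1" for x y
      using mono[OF that] by linarith
  qed (rule that)
  obtain q where q: "q absolutely_integrable_on {0..1}"
      "\<forall>x\<in>{0..1}. (variation f x - f x) - (variation f 0 - f 0) = integral {0..x} q"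
  proof (rule monotone_abs_cont_density[OF abs_cont_diff[OF abs_cont_variation[OF f] f]])
    show "variation f x - f x \<le> variation f y - f y" if "0 \<le> x" "x \<le> y" "y \<le> 1" for x y
      using mono[OF that] by linarith
  qed (rule that)
  show ?thesis
  proof
    show "(\<lambda>t. p t - q t) absolutely_integrable_on {0..1}"
      using p q by (intro set_integral_diff)
    show "\<forall>x\<in>{0..1}. f x - f 0 = integral {0..x} (\<lambda>t. p t - q t)"
    proof
      fix x :: real assume x: "x \<in> {0..1}"
      have "p integrable_on {0..x}" "q integrable_on {0..x}"
        using p(1) q(1) x by (auto intro!: integrable_on_subinterval[of _ "{0..1}"] simp: absolutely_integrable_on_def)
      then have "integral {0..x} (\<lambda>t. p t - q t) = integral {0..x} p - integral {0..x} q"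
        by (rule integral_diff)
      then show "f x - f 0 = integral {0..x} (\<lambda>t. p t - q t)"
        using bspec[OF p(2) x] bspec[OF q(2) x] by simp
    qed
  qed
qed

lemma abs_cont_eq_integral:
  fixes c :: "real \<Rightarrow> 'a::euclidean_space"
  assumes "abs_cont c"
  obtains g where "g absolutely_integrable_on {0..1}" "\<forall>x\<in>{0..1}. c x - c 0 = integral {0..x} g"
proof -
  have "\<exists>g. g absolutely_integrable_on {0..1} \<and> (\<forall>x\<in>{0..1}. c x \<bullet> i - c 0 \<bullet> i = integral {0..x} g)"
    if "i \<in> Basis" for i :: 'a
  proof -
    have "abs_cont (\<lambda>x. c x \<bullet> i)"
      using Basis_le_norm[OF that] by (intro abs_cont_mono[OF assms]) (simp flip: inner_diff_left)
    then show ?thesis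
      by (rule abs_cont_real_eq_integral) blast
  qed
  then obtain g where g: "\<And>i. i \<in> Basis \<Longrightarrow> g i absolutely_integrable_on {0..1}"
    "\<And>i x. i \<in> Basis \<Longrightarrow> x \<in> {0..1} \<Longrightarrow> c x \<bullet> i - c 0 \<bullet> i = integral {0..x} (g i)"
    by metis
  define G where "G = (\<lambda>t. \<Sum>i\<in>Basis. g i t *\<^sub>R i)"
  have G: "G absolutely_integrable_on {0..1}"
    unfolding G_def using g(1) by (intro absolutely_integrable_sum absolutely_integrable_scaleR_right) auto
  show ?thesis
  proof
    show "G absolutely_integrable_on {0..1}" by fact
    show "\<forall>x\<in>{0..1}. c x - c 0 = integral {0..x} G"
    proof
      fix x :: real assume x: "x \<in> {0..1}"
      have "G integrable_on {0..x}"
        using G x by (auto intro!: integrable_on_subinterval[of _ "{0..1}"] simp: absolutely_integrable_on_def)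
      then have component: "integral {0..x} G \<bullet> i = integral {0..x} (g i)" if "i \<in> Basis" for i
        using that integral_component_eq[of G "{0..x}" i] by (simp add: G_def)
      show "c x - c 0 = integral {0..x} G"
      proof (rule euclidean_eqI)
        fix i :: 'a assume i: "i \<in> Basis"
        show "(c x - c 0) \<bullet> i = integral {0..x} G \<bullet> i"
          unfolding component[OF i] inner_diff_left by (rule g(2)[OF i x])
      qed
    qed
  qed
qed

section \<open>Differentiation of indefinite integrals\<close>

text \<open>
  Up to an error of \<open>\<epsilon>/2\<close> in the integral, the norm can be truncated at a constant \<open>k\<close>, by dominated
  convergence; a set of measure less than \<open>\<epsilon> / (2 (k + 1))\<close> contributes at most \<open>\<epsilon>/2\<close> to the truncation.
\<close>

lemma integral_norm_small_on_small_sets: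
  fixes h :: "'a \<Rightarrow> 'b::{banach, second_countable_topology}"
  assumes h: "integrable M h" and "\<epsilon> > 0"
  obtains \<delta> where "\<delta> > 0"
    "\<forall>A\<in>sets M. emeasure M A < ennreal \<delta> \<longrightarrow> (\<integral>x. indicator A x * norm (h x) \<partial>M) < \<epsilon>"
proof -
  define m where "m = (\<lambda>(k::nat) x. min (norm (h x)) (real k))"
  have [measurable]: "h \<in> borel_measurable M"
    using h by simp
  have m_int: "integrable M (m k)" for k
    by (rule Bochner_Integration.integrable_bound[OF integrable_norm[OF h]]) (auto simp: m_def)
  have "(\<lambda>k. \<integral>x. m k x \<partial>M) \<longlonglongrightarrow> (\<integral>x. norm (h x) \<partial>M)"
  proof (rule integral_dominated_convergence[where w = "\<lambda>x. norm (h x)"])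
    show "AE x in M. (\<lambda>k. m k x) \<longlonglongrightarrow> norm (h x)"
    proof (intro AE_I2 tendsto_eventually)
      fix x
      obtain k :: nat where "norm (h x) \<le> real k"
        using real_arch_simple by blast
      then show "\<forall>\<^sub>F k in sequentially. m k x = norm (h x)"
        unfolding eventually_sequentially m_def by (intro exI[of _ k] allI impI) (simp add: min_absorb1)
    qed
  qed (auto simp: m_def h intro: integrable_norm)
  then have "\<forall>\<^sub>F k in sequentially. dist (\<integral>x. m k x \<partial>M) (\<integral>x. norm (h x) \<partial>M) < \<epsilon>/2"
    using \<open>\<epsilon> > 0\<close> by (intro tendstoD) auto
  then obtain k where k: "\<bar>(\<integral>x. m k x \<partial>M) - (\<integral>x. norm (h x) \<partial>M)\<bar> < \<epsilon>/2"
    unfolding eventually_sequentially dist_real_def by blast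
  define \<delta> where "\<delta> = \<epsilon> / 2 / (real k + 1)"
  have "\<delta> > 0"
    using \<open>\<epsilon> > 0\<close> by (simp add: \<delta>_def)
  have "(\<integral>x. indicator A x * norm (h x) \<partial>M) < \<epsilon>" if A[measurable]: "A \<in> sets M" and small: "emeasure M A < ennreal \<delta>" for A
  proof -
    have fin: "emeasure M A < \<infinity>"
      using order.strict_trans[OF small ennreal_less_top] by simp
    have meas: "measure M A < \<delta>"
    proof -
      have "ennreal (measure M A) < ennreal \<delta>"
        using small fin by (simp add: emeasure_eq_ennreal_measure)
      then show ?thesis
        by (simp add: ennreal_less_iff)
    qed
    have i1: "integrable M (\<lambda>x. norm (h x) - m k x)"
      using m_int h by (intro Bochner_Integration.integrable_diff integrable_norm)
    have i2: "integrable M (\<lambda>x. real k * indicator A x)"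
      using fin by (intro integrable_mult_right integrable_real_indicator) auto
    have "(\<integral>x. indicator A x * norm (h x) \<partial>M) \<le> (\<integral>x. (norm (h x) - m k x) + real k * indicator A x \<partial>M)"
    proof (rule integral_mono)
      show "integrable M (\<lambda>x. indicator A x * norm (h x))"
        using integrable_mult_indicator[OF A integrable_norm[OF h]] by simp
      show "integrable M (\<lambda>x. (norm (h x) - m k x) + real k * indicator A x)"
        by (rule Bochner_Integration.integrable_add[OF i1 i2])
      show "indicator A x * norm (h x) \<le> (norm (h x) - m k x) + real k * indicator A x" for x
        by (auto simp: m_def indicator_def)
    qed
    also have "\<dots> = (\<integral>x. norm (h x) - m k x \<partial>M) + (\<integral>x. real k * indicator A x \<partial>M)"
      by (rule Bochner_Integration.integral_add[OF i1 i2])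
    also have "(\<integral>x. norm (h x) - m k x \<partial>M) = (\<integral>x. norm (h x) \<partial>M) - (\<integral>x. m k x \<partial>M)"
      by (rule Bochner_Integration.integral_diff[OF integrable_norm[OF h] m_int])
    also have "(\<integral>x. real k * indicator A x \<partial>M) = real k * measure M A"
      by simp
    also have "real k * measure M A \<le> real k * \<delta>"
      using meas by (intro mult_left_mono) auto
    also have "real k * \<delta> \<le> \<epsilon>/2"
      using \<open>\<epsilon> > 0\<close> by (simp add: \<delta>_def field_simps)
    finally show ?thesis
      using k by linarith
  qed
  then show ?thesis
    using that[OF \<open>\<delta> > 0\<close>] by blast
qed

text \<open>
  With \<open>A = {f < a}\<close> choose an open \<open>U \<supseteq> A\<close> such that the integral of \<open>\<bar>f - a\<bar>\<close> over \<open>U - A\<close> is less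
  than \<open>e (b - a)\<close>. The intervals in \<open>U\<close> on which \<open>f\<close> has average above \<open>b\<close> form a Vitali cover of the set.
  For a disjoint finite selection with union \<open>W\<close>, the integral of \<open>f - a\<close> over \<open>W\<close> is at least \<open>(b - a) \<bar>W\<bar>\<close>, and at
  most \<open>e (b - a)\<close> because \<open>f - a\<close> is negative on \<open>A\<close>. Hence \<open>\<bar>W\<bar> \<le> e\<close>.
\<close>

lemma negligible_upper_derivate_gap:
  fixes f :: "real \<Rightarrow> real"
  assumes f: "f absolutely_integrable_on {0..1}" and "a < b"
  shows "negligible {x\<in>{0<..<1}. f x < a \<and>
    (\<forall>d>0. \<exists>u v. u \<le> x \<and> x \<le> v \<and> u < v \<and> v - u < d \<and> 0 \<le> u \<and> v \<le> 1 \<and> b * (v - u) < integral {u..v} f)}"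
    (is "negligible ?E")
  unfolding negligible_outer_le
proof (intro allI impI)
  fix e :: real assume "e > 0"
  define g where "g = (\<lambda>x. indicator {0..1} x * (f x - a))"
  have "(\<lambda>x. f x - a) absolutely_integrable_on {0..1}"
    using f by (intro set_integral_diff absolutely_integrable_on_const) auto
  then have g: "integrable lebesgue g"
    unfolding g_def set_integrable_def by simp
  then have [measurable]: "g \<in> borel_measurable lebesgue"
    by simp
  have "0 < e * (b - a)"
    using \<open>e > 0\<close> \<open>a < b\<close> by simp
  then obtain \<delta> where "\<delta> > 0" and \<delta>: "\<forall>B\<in>sets lebesgue. emeasure lebesgue B < ennreal \<delta> \<longrightarrow>
      (\<integral>x. indicator B x * norm (g x) \<partial>lebesgue) < e * (b - a)"
    using integral_norm_small_on_small_sets[OF g] by metis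
  define A where "A = {x\<in>{0<..<1}. f x < a}"
  have A_g: "A = {x\<in>space lebesgue. g x < 0} \<inter> {0<..<1}"
    unfolding A_def g_def by (auto simp: indicator_def)
  have "{x\<in>space lebesgue. g x < 0} \<in> sets lebesgue"
    by measurable
  then have A_sets: "A \<in> sets lebesgue"
    unfolding A_g by (rule sets.Int) simp
  obtain U' where U': "open U'" "A \<subseteq> U'" "U' - A \<in> lmeasurable" "emeasure lebesgue (U' - A) < ennreal \<delta>"
    using sets_lebesgue_outer_open[OF A_sets \<open>\<delta> > 0\<close>] by metis
  define U where "U = U' \<inter> {0<..<1}"
  have U: "open U" "A \<subseteq> U" "U \<subseteq> {0<..<1}"
    using U' unfolding U_def A_def by auto
  have UA_sets: "U - A \<in> sets lebesgue"
    using U(1) A_sets by auto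
  have UA: "(\<integral>x. indicator (U - A) x * norm (g x) \<partial>lebesgue) < e * (b - a)"
  proof -
    have "emeasure lebesgue (U - A) \<le> emeasure lebesgue (U' - A)"
      using U'(3) by (intro emeasure_mono) (auto simp: U_def)
    also note U'(4)
    finally show ?thesis
      using \<delta> UA_sets by blast
  qed
  define K where "K = {(u,v). u < v \<and> {u..v} \<subseteq> U \<and> b * (v - u) < integral {u..v} f}"
  \<comment> \<open>Vitali covers consist of closed balls: an interval is the ball around its midpoint.\<close>
  define ctr rad :: "real \<times> real \<Rightarrow> real"
    where "ctr = (\<lambda>p. (fst p + snd p)/2)" and "rad = (\<lambda>p. (snd p - fst p)/2)"
  have ball: "cball (ctr p) (rad p) = {fst p..snd p}" for p
    by (simp add: cball_eq_atLeastAtMost ctr_def rad_def field_simps)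
  have K: "fst p < snd p" "{fst p..snd p} \<subseteq> U" "b * (snd p - fst p) < integral {fst p..snd p} f" if "p \<in> K" for p
    using that by (auto simp: K_def)
  obtain C where C: "countable C" "C \<subseteq> K"
    and pw: "pairwise (\<lambda>p q. disjnt (cball (ctr p) (rad p)) (cball (ctr q) (rad q))) C"
    and null: "negligible (?E - (\<Union>p\<in>C. cball (ctr p) (rad p)))"
  proof (rule Vitali_covering_theorem_cballs)
    show "0 < rad p" if "p \<in> K" for p
      using K(1)[OF that] by (simp add: rad_def)
    fix x d :: real
    assume x: "x \<in> ?E" and "0 < d"
    then have "x \<in> U"
      using U(2) by (auto simp: A_def)
    then obtain r where "r > 0" and r: "ball x r \<subseteq> U"
      using U(1) openE by blast
    have "min d r > 0"
      using \<open>0 < d\<close> \<open>r > 0\<close> by simp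
    with x obtain u v where uv: "u \<le> x" "x \<le> v" "u < v" "v - u < min d r" "b * (v - u) < integral {u..v} f"
      by blast
    have "{u..v} \<subseteq> ball x r"
      using uv by (auto simp: dist_real_def)
    then have "(u,v) \<in> K"
      using uv r by (auto simp: K_def)
    moreover have "x \<in> cball (ctr (u,v)) (rad (u,v))" "rad (u,v) < d"
      unfolding ball using uv by (auto simp: rad_def)
    ultimately show "\<exists>p. p \<in> K \<and> x \<in> cball (ctr p) (rad p) \<and> rad p < d"
      by blast
  qed (rule that)
  have meas: "{fst p..snd p} \<in> lmeasurable" for p :: "real \<times> real"
    by simp
  have part: "measure lebesgue (\<Union>p\<in>F. {fst p..snd p}) \<le> e" if F: "F \<subseteq> C" "finite F" for F
  proof -
    let ?W = "\<Union>p\<in>F. {fst p..snd p}"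
    have FK: "p \<in> K" if "p \<in> F" for p
      using that F(1) C(2) by blast
    have g_set: "set_integrable lebesgue B g" if "B \<in> sets lebesgue" for B
      unfolding set_integrable_def using integrable_mult_indicator[OF that g] by simp
    have piece: "(b - a) * (snd p - fst p) \<le> (LINT x:{fst p..snd p}|lebesgue. g x)" if "p \<in> F" for p
    proof -
      note p = K[OF FK[OF that]]
      have sub: "{fst p..snd p} \<subseteq> {0..1}"
        using p(2) U(3) by force
      have fi: "f integrable_on {fst p..snd p}"
        using f sub by (metis absolutely_integrable_on_def integrable_on_subinterval)
      have "(LINT x:{fst p..snd p}|lebesgue. g x) = integral {fst p..snd p} g"
        by (rule set_lebesgue_integral_eq_integral(2)[OF g_set]) simp
      also have "\<dots> = integral {fst p..snd p} (\<lambda>x. f x - a)"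
        using sub by (intro integral_cong) (auto simp: g_def indicator_def)
      also have "\<dots> = integral {fst p..snd p} f - a * (snd p - fst p)"
        using p(1) integral_diff[OF fi integrable_const_ivl[of a]] by (simp add: mult.commute)
      finally show ?thesis
        using p(3) by (simp add: algebra_simps)
    qed
    have "(b - a) * measure lebesgue ?W \<le> (b - a) * (\<Sum>p\<in>F. measure lebesgue {fst p..snd p})"
      using F(2) \<open>a < b\<close> by (intro mult_left_mono measure_UNION_le) auto
    also have "\<dots> = (\<Sum>p\<in>F. (b - a) * (snd p - fst p))"
      unfolding sum_distrib_left using K(1) FK by (intro sum.cong) (auto simp: less_imp_le)
    also have "\<dots> \<le> (\<Sum>p\<in>F. LINT x:{fst p..snd p}|lebesgue. g x)"
      by (intro sum_mono piece)
    also have "\<dots> = (LINT x:?W|lebesgue. g x)"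
    proof (rule set_integral_finite_Union[symmetric])
      show "disjoint_family_on (\<lambda>p. {fst p..snd p}) F"
        unfolding disjoint_family_on_def
      proof (intro ballI impI)
        fix p q assume "p \<in> F" "q \<in> F" "p \<noteq> q"
        then have "disjnt {fst p..snd p} {fst q..snd q}"
          using pw F(1) unfolding ball pairwise_def by (meson subsetD)
        then show "{fst p..snd p} \<inter> {fst q..snd q} = {}"
          by (simp only: disjnt_def)
      qed
    qed (auto intro: g_set F(2))
    also have "\<dots> \<le> (\<integral>x. indicator (U - A) x * norm (g x) \<partial>lebesgue)"
      unfolding set_lebesgue_integral_def
    proof (rule integral_mono)
      show "integrable lebesgue (\<lambda>x. indicat_real ?W x *\<^sub>R g x)"
        using g_set[of ?W] F(2) unfolding set_integrable_def by (simp add: sets.finite_UN)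
      show "integrable lebesgue (\<lambda>x. indicator (U - A) x * norm (g x))"
        using integrable_mult_indicator[OF UA_sets integrable_norm[OF g]] by simp
      fix x
      have "x \<in> U" if "x \<in> ?W"
        using that K(2) FK by blast
      moreover have "g x < 0" if "x \<in> A"
        using that unfolding A_g by simp
      ultimately show "indicat_real ?W x *\<^sub>R g x \<le> indicator (U - A) x * norm (g x)"
        by (cases "x \<in> ?W"; cases "x \<in> A") (auto simp: indicator_def)
    qed
    also note UA
    finally show ?thesis
      using \<open>a < b\<close> by (simp add: mult.commute)
  qed
  let ?T = "\<Union>p\<in>C. {fst p..snd p}"
  show "\<exists>T. ?E \<subseteq> T \<and> T \<in> lmeasurable \<and> measure lebesgue T \<le> e"
  proof (intro exI conjI)
    let ?N = "?E - ?T"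
    have N: "?N \<in> null_sets lebesgue"
      using null unfolding ball negligible_iff_null_sets .
    have T: "?T \<in> lmeasurable" "measure lebesgue ?T \<le> e"
      using fmeasurable_UN_bound[OF C(1) meas part] measure_UN_bound[OF C(1) meas part] by blast+
    show "?E \<subseteq> ?T \<union> ?N"
      by blast
    show "?T \<union> ?N \<in> lmeasurable"
      using T(1) N by (intro fmeasurable.Un) (auto simp: negligible_iff_null_sets negligible_imp_measurable)
    show "measure lebesgue (?T \<union> ?N) \<le> e"
      unfolding measure_Un_null_set[OF fmeasurableD[OF T(1)] N] by (rule T(2))
  qed
qed

text \<open>
  The exceptional set is the union of the null sets of the preceding lemma over all rational \<open>a < b\<close>.
\<close>

lemma averages_eventually_below:
  fixes f :: "real \<Rightarrow> real"
  assumes f: "f absolutely_integrable_on {0..1}"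
  obtains N where "negligible N"
    "\<forall>x\<in>{0<..<1} - N. \<forall>\<epsilon>>0. \<exists>d>0. \<forall>u v. u \<le> x \<and> x \<le> v \<and> u < v \<and> v - u < d \<and> 0 \<le> u \<and> v \<le> 1 \<longrightarrow>
       integral {u..v} f \<le> (f x + \<epsilon>) * (v - u)"
proof -
  define E where "E = (\<lambda>p::rat\<times>rat. {x\<in>{0<..<1}. f x < of_rat (fst p) \<and>
    (\<forall>d>0. \<exists>u v. u \<le> x \<and> x \<le> v \<and> u < v \<and> v - u < d \<and> 0 \<le> u \<and> v \<le> 1 \<and>
       of_rat (snd p) * (v - u) < integral {u..v} f)})"
  define N where "N = (\<Union>p\<in>{p. fst p < snd p}. E p)"
  have "negligible (E p)" if "fst p < snd p" for p
    unfolding E_def using that by (intro negligible_upper_derivate_gap[OF f]) (simp add: of_rat_less)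
  then have N: "negligible N"
    unfolding N_def by (intro negligible_countable_Union countable_image) auto
  have "\<exists>d>0. \<forall>u v. u \<le> x \<and> x \<le> v \<and> u < v \<and> v - u < d \<and> 0 \<le> u \<and> v \<le> 1 \<longrightarrow>
      integral {u..v} f \<le> (f x + \<epsilon>) * (v - u)" if x: "x \<in> {0<..<1} - N" and "\<epsilon> > 0" for x \<epsilon>
  proof -
    obtain r :: rat where r: "f x < of_rat r" "of_rat r < f x + \<epsilon>"
      using of_rat_dense[of "f x" "f x + \<epsilon>"] \<open>\<epsilon> > 0\<close> by auto
    obtain s :: rat where s: "of_rat r < (of_rat s :: real)" "of_rat s < f x + \<epsilon>"
      using of_rat_dense[OF r(2)] by auto
    have "fst (r,s) < snd (r,s)"
      using s(1) by (simp add: of_rat_less)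
    then have "x \<notin> E (r,s)"
      using x unfolding N_def by blast
    then obtain d where "d > 0" and d: "\<And>u v. u \<le> x \<Longrightarrow> x \<le> v \<Longrightarrow> u < v \<Longrightarrow> v - u < d \<Longrightarrow> 0 \<le> u \<Longrightarrow> v \<le> 1 \<Longrightarrow>
        \<not> of_rat s * (v - u) < integral {u..v} f"
      using x r(1) unfolding E_def by auto
    show ?thesis
    proof (intro exI[of _ d] conjI allI impI \<open>d > 0\<close>)
      fix u v assume uv: "u \<le> x \<and> x \<le> v \<and> u < v \<and> v - u < d \<and> 0 \<le> u \<and> v \<le> 1"
      then have "integral {u..v} f \<le> of_rat s * (v - u)"
        using d[of u v] by linarith
      also have "\<dots> \<le> (f x + \<epsilon>) * (v - u)"
        using s(2) uv by (intro mult_right_mono) auto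
      finally show "integral {u..v} f \<le> (f x + \<epsilon>) * (v - u)" .
    qed
  qed
  then show ?thesis
    using that[OF N] by blast
qed

text \<open>
  The averages are bounded from above by the preceding lemma for \<open>f\<close>, and from below by the same lemma for \<open>-f\<close>.
\<close>

lemma integral_has_real_derivative_AE:
  fixes f :: "real \<Rightarrow> real"
  assumes f: "f absolutely_integrable_on {0..1}"
  obtains N where "negligible N"
    "\<forall>x\<in>{0<..<1} - N. ((\<lambda>y. integral {0..y} f) has_derivative (\<lambda>h. h * f x)) (at x within {0..1})"
proof -
  have mf: "(\<lambda>t. - f t) absolutely_integrable_on {0..1}"
    using absolutely_integrable_scaleR_left[OF f, of "-1"] by simp
  have fi: "f integrable_on {u..v}" if "0 \<le> u" "v \<le> 1" for u v
    using f that by (auto intro!: integrable_on_subinterval[of _ "{0..1}"] simp: absolutely_integrable_on_def)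
  obtain N1 where N1: "negligible N1"
    "\<forall>x\<in>{0<..<1} - N1. \<forall>\<epsilon>>0. \<exists>d>0. \<forall>u v. u \<le> x \<and> x \<le> v \<and> u < v \<and> v - u < d \<and> 0 \<le> u \<and> v \<le> 1 \<longrightarrow>
       integral {u..v} f \<le> (f x + \<epsilon>) * (v - u)"
    using averages_eventually_below[OF f] by metis
  obtain N2 where N2: "negligible N2"
    "\<forall>x\<in>{0<..<1} - N2. \<forall>\<epsilon>>0. \<exists>d>0. \<forall>u v. u \<le> x \<and> x \<le> v \<and> u < v \<and> v - u < d \<and> 0 \<le> u \<and> v \<le> 1 \<longrightarrow>
       integral {u..v} (\<lambda>t. - f t) \<le> (- f x + \<epsilon>) * (v - u)"
    using averages_eventually_below[OF mf] by metis
  have "((\<lambda>y. integral {0..y} f) has_derivative (\<lambda>h. h * f x)) (at x within {0..1})"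
    if x: "x \<in> {0<..<1} - (N1 \<union> N2)" for x
    unfolding has_derivative_within_alt
  proof (intro conjI allI impI)
    show "bounded_linear (\<lambda>h. h * f x)"
      by (rule bounded_linear_mult_left)
    fix \<epsilon> :: real assume "\<epsilon> > 0"
    obtain d1 where "d1 > 0" and d1: "\<forall>u v. u \<le> x \<and> x \<le> v \<and> u < v \<and> v - u < d1 \<and> 0 \<le> u \<and> v \<le> 1 \<longrightarrow>
       integral {u..v} f \<le> (f x + \<epsilon>) * (v - u)"
      using N1(2) x \<open>\<epsilon> > 0\<close> by blast
    obtain d2 where "d2 > 0" and d2: "\<forall>u v. u \<le> x \<and> x \<le> v \<and> u < v \<and> v - u < d2 \<and> 0 \<le> u \<and> v \<le> 1 \<longrightarrow>
       integral {u..v} (\<lambda>t. - f t) \<le> (- f x + \<epsilon>) * (v - u)"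
      using N2(2) x \<open>\<epsilon> > 0\<close> by blast
    have avg: "\<bar>integral {u..v} f - (v - u) * f x\<bar> \<le> \<epsilon> * (v - u)"
      if "u \<le> x" "x \<le> v" "u < v" "v - u < min d1 d2" "0 \<le> u" "v \<le> 1" for u v
      using d1[rule_format, of u v] d2[rule_format, of u v] that
      by (simp add: abs_le_iff algebra_simps)
    show "\<exists>d>0. \<forall>y\<in>{0..1}. norm (y - x) < d \<longrightarrow>
        norm (integral {0..y} f - integral {0..x} f - (y - x) * f x) \<le> \<epsilon> * norm (y - x)"
    proof (intro exI[of _ "min d1 d2"] conjI ballI impI)
      show "0 < min d1 d2"
        using \<open>d1 > 0\<close> \<open>d2 > 0\<close> by simp
      fix y assume y: "y \<in> {0..1}" "norm (y - x) < min d1 d2"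
      consider "y = x" | "x < y" | "y < x" by linarith
      then show "norm (integral {0..y} f - integral {0..x} f - (y - x) * f x) \<le> \<epsilon> * norm (y - x)"
      proof cases
        case 2
        have "integral {0..x} f + integral {x..y} f = integral {0..y} f"
          using x y 2 by (intro Henstock_Kurzweil_Integration.integral_combine fi) auto
        moreover have "\<bar>integral {x..y} f - (y - x) * f x\<bar> \<le> \<epsilon> * (y - x)"
          using x y 2 by (intro avg) auto
        ultimately show ?thesis
          using 2 by (simp add: algebra_simps)
      next
        case 3
        have "integral {0..y} f + integral {y..x} f = integral {0..x} f"
          using x y 3 by (intro Henstock_Kurzweil_Integration.integral_combine fi) auto
        moreover have "\<bar>integral {y..x} f - (x - y) * f x\<bar> \<le> \<epsilon> * (x - y)"
          using x y 3 by (intro avg) auto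
        ultimately show ?thesis
          using 3 by (simp add: abs_le_iff algebra_simps)
      qed simp
    qed
  qed
  moreover have "negligible (N1 \<union> N2)"
    using N1(1) N2(1) by (rule negligible_Un)
  ultimately show ?thesis
    using that by blast
qed

lemma integral_has_vector_derivative_AE:
  fixes f :: "real \<Rightarrow> 'a::euclidean_space"
  assumes f: "f absolutely_integrable_on {0..1}"
  obtains N where "negligible N"
    "\<forall>x\<in>{0<..<1} - N. ((\<lambda>y. integral {0..y} f) has_vector_derivative f x) (at x within {0..1})"
proof -
  have fb: "(\<lambda>t. f t \<bullet> i) absolutely_integrable_on {0..1}" if "i \<in> Basis" for i
    using absolutely_integrable_component[OF f] .
  have "\<exists>N. negligible N \<and> (\<forall>x\<in>{0<..<1} - N.
      ((\<lambda>y. integral {0..y} (\<lambda>t. f t \<bullet> i)) has_derivative (\<lambda>h. h * (f x \<bullet> i))) (at x within {0..1}))"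
    if "i \<in> Basis" for i
    using integral_has_real_derivative_AE[OF fb[OF that]] by metis
  then obtain N where N: "\<And>i. i \<in> Basis \<Longrightarrow> negligible (N i)"
    and der: "\<And>i x. i \<in> Basis \<Longrightarrow> x \<in> {0<..<1} - N i \<Longrightarrow>
      ((\<lambda>y. integral {0..y} (\<lambda>t. f t \<bullet> i)) has_derivative (\<lambda>h. h * (f x \<bullet> i))) (at x within {0..1})"
    by metis
  have "((\<lambda>y. integral {0..y} f) has_vector_derivative f x) (at x within {0..1})"
    if x: "x \<in> {0<..<1} - (\<Union>i\<in>Basis. N i)" for x
    unfolding has_vector_derivative_def has_derivative_componentwise_within[of "\<lambda>y. integral {0..y} f"]
  proof
    fix i :: 'a assume i: "i \<in> Basis"
    have eq: "integral {0..y} (\<lambda>t. f t \<bullet> i) = integral {0..y} f \<bullet> i" if "y \<in> {0..1}" for y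
    proof (rule integral_component_eq)
      show "f integrable_on {0..y}"
        using f that by (auto intro!: integrable_on_subinterval[of _ "{0..1}"] simp: absolutely_integrable_on_def)
    qed
    have "x \<in> {0<..<1} - N i"
      using x i by blast
    from der[OF i this]
    have "((\<lambda>y. integral {0..y} f \<bullet> i) has_derivative (\<lambda>h. h * (f x \<bullet> i))) (at x within {0..1})"
      by (rule has_derivative_transform[rotated 2]) (use x eq in auto)
    then show "((\<lambda>y. integral {0..y} f \<bullet> i) has_derivative (\<lambda>h. h *\<^sub>R f x \<bullet> i)) (at x within {0..1})"
      by simp
  qed
  moreover have "negligible (\<Union>i\<in>Basis. N i)"
    using N by (intro negligible_Union) auto
  ultimately show ?thesis
    using that by blast
qed

lemma abs_cont_integral:
  fixes f :: "real \<Rightarrow> 'a::euclidean_space"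
  assumes f: "f absolutely_integrable_on {0..1}"
  shows "abs_cont (\<lambda>x. integral {0..x} f)"
  unfolding abs_cont_def
proof (intro allI impI)
  fix \<epsilon> :: real assume "\<epsilon> > 0"
  define h where "h = (\<lambda>x. indicator {0..1} x *\<^sub>R f x)"
  have h: "integrable lebesgue h"
    using f unfolding h_def set_integrable_def .
  have h_set: "set_integrable lebesgue B h" if "B \<in> sets lebesgue" for B
    unfolding set_integrable_def by (rule integrable_mult_indicator[OF that h])
  have nh_set: "set_integrable lebesgue B (\<lambda>x. norm (h x))" if "B \<in> sets lebesgue" for B
    unfolding set_integrable_def by (rule integrable_mult_indicator[OF that integrable_norm[OF h]])
  obtain \<delta> where "\<delta> > 0" and \<delta>: "\<forall>A\<in>sets lebesgue. emeasure lebesgue A < ennreal \<delta> \<longrightarrow>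
      (\<integral>x. indicator A x * norm (h x) \<partial>lebesgue) < \<epsilon>"
    using integral_norm_small_on_small_sets[OF h \<open>\<epsilon> > 0\<close>] by metis
  show "\<exists>\<delta>>0. \<forall>(S::nat set) a b. nonoverlapping 0 1 S a b \<and> (\<Sum>i\<in>S. b i - a i) < \<delta> \<longrightarrow>
      (\<Sum>i\<in>S. norm (integral {0..b i} f - integral {0..a i} f)) < \<epsilon>"
  proof (intro exI[of _ \<delta>] conjI allI impI \<open>\<delta> > 0\<close>, elim conjE)
    fix S :: "nat set" and a b
    assume S: "nonoverlapping 0 1 S a b" and less: "(\<Sum>i\<in>S. b i - a i) < \<delta>"
    have fin: "finite S" and ab: "\<And>i. i \<in> S \<Longrightarrow> 0 \<le> a i \<and> a i \<le> b i \<and> b i \<le> 1"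
      and disj: "disjoint_family_on (\<lambda>i. {a i<..<b i}) S"
      using S by (simp_all add: nonoverlapping_def)
    let ?W = "\<Union>i\<in>S. {a i<..<b i}"
    have W: "?W \<in> sets lebesgue"
      using fin by (intro sets.finite_UN) auto
    have incr: "norm (integral {0..b i} f - integral {0..a i} f) \<le> (LINT x:{a i<..<b i}|lebesgue. norm (h x))"
      if "i \<in> S" for i
    proof -
      note i = ab[OF that]
      have "f integrable_on {0..b i}"
        using f i by (auto intro!: integrable_on_subinterval[of _ "{0..1}"] simp: absolutely_integrable_on_def)
      then have "integral {0..a i} f + integral {a i..b i} f = integral {0..b i} f"
        using i by (intro Henstock_Kurzweil_Integration.integral_combine) auto
      then have "integral {0..b i} f - integral {0..a i} f = integral {a i<..<b i} f"
        unfolding integral_open_interval_real[symmetric] by (simp add: algebra_simps)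
      also have "\<dots> = integral {a i<..<b i} h"
        using i by (intro integral_cong) (auto simp: h_def)
      also have "\<dots> = (LINT x:{a i<..<b i}|lebesgue. h x)"
        by (rule set_lebesgue_integral_eq_integral(2)[OF h_set, symmetric]) simp
      also have "norm \<dots> \<le> (LINT x:{a i<..<b i}|lebesgue. norm (h x))"
        by (rule set_integral_norm_bound[OF h_set]) simp
      finally show ?thesis .
    qed
    have "(\<Sum>i\<in>S. norm (integral {0..b i} f - integral {0..a i} f)) \<le>
        (\<Sum>i\<in>S. LINT x:{a i<..<b i}|lebesgue. norm (h x))"
      by (rule sum_mono[OF incr])
    also have "\<dots> = (LINT x:?W|lebesgue. norm (h x))"
      by (rule set_integral_finite_Union[symmetric, OF fin disj nh_set]) auto
    also have "\<dots> = (\<integral>x. indicator ?W x * norm (h x) \<partial>lebesgue)"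
      by (simp add: set_lebesgue_integral_def)
    also have "\<dots> < \<epsilon>"
    proof -
      have "emeasure lebesgue ?W = (\<Sum>i\<in>S. emeasure lebesgue {a i<..<b i})"
        using fin disj by (intro sum_emeasure[symmetric]) auto
      also have "\<dots> = (\<Sum>i\<in>S. ennreal (b i - a i))"
        using ab by (intro sum.cong) simp_all
      also have "\<dots> = ennreal (\<Sum>i\<in>S. b i - a i)"
        using ab by (intro sum_ennreal) simp
      also have "\<dots> < ennreal \<delta>"
        using less \<open>\<delta> > 0\<close> by (simp add: ennreal_lessI)
      finally show ?thesis
        using \<delta> W by blast
    qed
    finally show "(\<Sum>i\<in>S. norm (integral {0..b i} f - integral {0..a i} f)) < \<epsilon>" .
  qed
qed

section \<open>Curves and their velocities\<close>

lemma integrable_lebesgue_on_unit_iff: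
  "integrable (lebesgue_on {0..1::real}) f \<longleftrightarrow> f absolutely_integrable_on {0..1}"
  by (simp add: integrable_restrict_space set_integrable_def)

lemma AE_lebesgue_on_iff_negligible:
  assumes "S \<in> sets lebesgue"
  shows "(AE t in lebesgue_on S. P t) \<longleftrightarrow> (\<exists>N. negligible N \<and> (\<forall>t\<in>S - N. P t))"
proof -
  have "(AE t in lebesgue_on S. P t) \<longleftrightarrow> (AE t in lebesgue. t \<in> S \<longrightarrow> P t)"
    using assms by (intro AE_restrict_space_iff) simp
  also have "\<dots> \<longleftrightarrow> (\<exists>N. negligible N \<and> {t. \<not> (t \<in> S \<longrightarrow> P t)} \<subseteq> N)"
    by (rule eventually_ae_filter_negligible)
  also have "\<dots> \<longleftrightarrow> (\<exists>N. negligible N \<and> (\<forall>t\<in>S - N. P t))"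
    by (intro ex_cong1 conj_cong refl) blast
  finally show ?thesis .
qed

lemma borel_measurable_lebesgue_on_AE:
  fixes f g :: "'a::euclidean_space \<Rightarrow> 'b::euclidean_space"
  assumes S: "S \<in> sets lebesgue" and f: "f \<in> borel_measurable (lebesgue_on S)"
    and ae: "AE t in lebesgue_on S. f t = g t"
  shows "g \<in> borel_measurable (lebesgue_on S)"
proof -
  let ?r = "\<lambda>h x. if x \<in> S then h x else (0::'b)"
  have "?r f \<in> borel_measurable lebesgue"
    using f borel_measurable_if[OF S, of f] by simp
  moreover have "AE x in lebesgue. ?r f x = ?r g x"
  proof -
    have "AE x in lebesgue. x \<in> S \<longrightarrow> f x = g x"
      using ae S by (subst (asm) AE_restrict_space_iff) auto
    then show ?thesis
      by eventually_elim simp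
  qed
  ultimately have "?r g \<in> borel_measurable lebesgue"
    by (rule borel_measurable_AE)
  then show ?thesis
    using borel_measurable_if[OF S, of g] by simp
qed

lemma velocity_cong:
  assumes "t \<in> I01" "\<And>s. s \<in> I01 \<Longrightarrow> c s = d s"
  shows "velocity c t = velocity d t"
  unfolding velocity_def using assms by (intro vector_derivative_cong_eq) auto

lemma velocity_eqI:
  assumes "t \<in> I01" "(c has_vector_derivative v) (at t within I01)"
  shows "velocity c t = v"
  unfolding velocity_def using assms by (intro vector_derivative_within_closed_interval) auto

text \<open>
  This holds at every point of the interval, even where the derivative does not exist: there the arbitrary value
  of \<^const>\<open>vector_derivative\<close> is the same for \<open>c\<close> and \<open>-c\<close>. It makes \<^const>\<open>AC_dist\<close> symmetric for all pairs of
  functions, as the locale \<^locale>\<open>Metric_space\<close> demands.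
\<close>

lemma norm_velocity_minus:
  assumes t: "t \<in> I01"
  shows "norm (velocity (\<lambda>s. - c s) t) = norm (velocity c t)"
proof (cases "\<exists>v. (c has_vector_derivative v) (at t within I01)")
  case True
  then obtain v where v: "(c has_vector_derivative v) (at t within I01)" by blast
  then have "((\<lambda>s. - c s) has_vector_derivative - v) (at t within I01)"
    by (rule has_vector_derivative_minus)
  then have "velocity (\<lambda>s. - c s) t = - v"
    by (rule velocity_eqI[OF t])
  then show ?thesis
    using velocity_eqI[OF t v] by simp
next
  case False
  have "\<not> ((\<lambda>s. - c s) has_vector_derivative v) (at t within I01)" for v
  proof
    assume "((\<lambda>s. - c s) has_vector_derivative v) (at t within I01)"
    then have "((\<lambda>s. - (- c s)) has_vector_derivative - v) (at t within I01)"
      by (rule has_vector_derivative_minus)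
    then show False
      using False by simp
  qed
  then show ?thesis
    using False by (simp add: velocity_def vector_derivative_def)
qed

text \<open>
  The restriction makes the values outside the interval \<^const>\<open>undefined\<close>, as for all elements of \<^const>\<open>AC0\<close>.
\<close>

definition primitive :: "(real \<Rightarrow> real ^ 'n) \<Rightarrow> real \<Rightarrow> real ^ 'n" where
  "primitive f = restrict (\<lambda>x. integral {0..x} f) I01"

lemma primitive_in_AC0:
  assumes "integrable (lebesgue_on I01) f"
  shows "primitive f \<in> AC0"
proof -
  have f: "f absolutely_integrable_on I01"
    using assms by (simp add: integrable_lebesgue_on_unit_iff)
  have "abs_cont (primitive f)"
    unfolding abs_cont_def
  proof (intro allI impI)
    fix \<epsilon> :: real assume "\<epsilon> > 0"
    then obtain \<delta> where "\<delta> > 0" and \<delta>: "\<forall>(S::nat set) a b. nonoverlapping 0 1 S a b \<and>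
        (\<Sum>i\<in>S. b i - a i) < \<delta> \<longrightarrow> (\<Sum>i\<in>S. norm (integral {0..b i} f - integral {0..a i} f)) < \<epsilon>"
      using abs_cont_integral[OF f] unfolding abs_cont_def by meson
    show "\<exists>\<delta>>0. \<forall>(S::nat set) a b. nonoverlapping 0 1 S a b \<and> (\<Sum>i\<in>S. b i - a i) < \<delta> \<longrightarrow>
        (\<Sum>i\<in>S. norm (primitive f (b i) - primitive f (a i))) < \<epsilon>"
    proof (intro exI[of _ \<delta>] conjI allI impI \<open>\<delta> > 0\<close>)
      fix S :: "nat set" and a b
      assume S: "nonoverlapping 0 1 S a b \<and> (\<Sum>i\<in>S. b i - a i) < \<delta>"
      have "(\<Sum>i\<in>S. norm (primitive f (b i) - primitive f (a i))) =
          (\<Sum>i\<in>S. norm (integral {0..b i} f - integral {0..a i} f))"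
      proof (rule sum.cong[OF refl])
        fix i assume "i \<in> S"
        then have "0 \<le> a i \<and> a i \<le> b i \<and> b i \<le> 1"
          using S unfolding nonoverlapping_def by blast
        then show "norm (primitive f (b i) - primitive f (a i)) = norm (integral {0..b i} f - integral {0..a i} f)"
          by (simp add: primitive_def)
      qed
      also have "\<dots> < \<epsilon>"
        using \<delta> S by blast
      finally show "(\<Sum>i\<in>S. norm (primitive f (b i) - primitive f (a i))) < \<epsilon>" .
    qed
  qed
  then show ?thesis
    by (simp add: AC0_def absolutely_continuous_curve_iff primitive_def)
qed

lemma velocity_primitive:
  assumes "integrable (lebesgue_on I01) f"
  shows "AE t in lebesgue_on I01. velocity (primitive f) t = f t"
proof -
  have f: "f absolutely_integrable_on I01"
    using assms by (simp add: integrable_lebesgue_on_unit_iff)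
  obtain N where N: "negligible N"
    "\<forall>x\<in>{0<..<1} - N. ((\<lambda>y. integral {0..y} f) has_vector_derivative f x) (at x within {0..1})"
    using integral_has_vector_derivative_AE[OF f] by metis
  have "velocity (primitive f) t = f t" if t: "t \<in> I01 - (N \<union> {0,1})" for t
  proof -
    have "velocity (primitive f) t = velocity (\<lambda>y. integral {0..y} f) t"
      using t by (intro velocity_cong) (auto simp: primitive_def)
    also have "\<dots> = f t"
      using t N(2) by (intro velocity_eqI) auto
    finally show ?thesis .
  qed
  moreover have "negligible (N \<union> {0,1})"
    by (rule negligible_Un[OF N(1)]) simp
  moreover have "I01 \<in> sets lebesgue"
    by simp
  ultimately show ?thesis
    using AE_lebesgue_on_iff_negligible by blast
qed

lemma primitive_cong_AE:
  assumes "AE t in lebesgue_on I01. f t = g t"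
  shows "primitive f = primitive g"
proof -
  obtain N where N: "negligible N" "\<forall>t\<in>I01 - N. f t = g t"
    using assms by (subst (asm) AE_lebesgue_on_iff_negligible) auto
  have "integral {0..x} f = integral {0..x} g" if "x \<in> I01" for x
    using N that by (intro integral_spike[OF N(1)]) auto
  then show ?thesis
    unfolding primitive_def by (intro restrict_ext)
qed

lemma AC0_eq_primitive:
  assumes "c \<in> AC0"
  obtains f where "integrable (lebesgue_on I01) f" "c = primitive f"
proof -
  have c: "c \<in> extensional I01" "abs_cont c" "c 0 = 0"
    using assms by (simp_all add: AC0_def absolutely_continuous_curve_iff)
  obtain f where f: "f absolutely_integrable_on I01" "\<forall>x\<in>I01. c x - c 0 = integral {0..x} f"
    using abs_cont_eq_integral[OF c(2)] by metis
  have "c = primitive f"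
    using f(2) c(1,3) by (intro extensionalityI[of _ I01]) (auto simp: primitive_def)
  then show ?thesis
    using that f(1) by (simp add: integrable_lebesgue_on_unit_iff)
qed

text \<open>
  Together with \<open>velocity_primitive\<close> this makes differentiation and integration mutually inverse, up to null
  sets on the side of the integrable functions.
\<close>

lemma AC0_velocity:
  assumes "c \<in> AC0"
  shows "integrable (lebesgue_on I01) (velocity c)" "primitive (velocity c) = c"
proof -
  obtain f where f: "integrable (lebesgue_on I01) f" "c = primitive f"
    using AC0_eq_primitive[OF assms] .
  have ae: "AE t in lebesgue_on I01. f t = velocity c t"
    using velocity_primitive[OF f(1)] unfolding f(2) by eventually_elim simp
  have "velocity c \<in> borel_measurable (lebesgue_on I01)"
    using f(1) by (intro borel_measurable_lebesgue_on_AE[OF _ _ ae]) auto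
  then show "integrable (lebesgue_on I01) (velocity c)"
    using integrable_cong_AE[OF borel_measurable_integrable[OF f(1)] _ ae] f(1) by blast
  show "primitive (velocity c) = c"
    unfolding primitive_cong_AE[OF ae, symmetric] by (rule f(2)[symmetric])
qed

text \<open>
  The velocity is additive only where the derivatives exist, so the claim is reduced to primitives: the
  difference of the two velocities has \<open>c - d\<close> as its primitive, and a primitive has its integrand as
  velocity almost everywhere.
\<close>

lemma velocity_diff:
  assumes c: "c \<in> AC0" and d: "d \<in> AC0"
  shows "AE t in lebesgue_on I01. velocity (\<lambda>s. c s - d s) t = velocity c t - velocity d t"
proof -
  let ?v = "\<lambda>t. velocity c t - velocity d t"
  note vc = AC0_velocity[OF c] and vd = AC0_velocity[OF d]
  have eq: "primitive ?v s = c s - d s" if s: "s \<in> I01" for s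
  proof -
    have "velocity c integrable_on {0..s}" "velocity d integrable_on {0..s}"
      using vc(1) vd(1) s unfolding integrable_lebesgue_on_unit_iff
      by (auto intro!: integrable_on_subinterval[of _ "{0..1}"] simp: absolutely_integrable_on_def)
    then have "primitive ?v s = primitive (velocity c) s - primitive (velocity d) s"
      using s by (simp add: primitive_def integral_diff)
    then show ?thesis
      unfolding vc(2) vd(2) .
  qed
  have "integrable (lebesgue_on I01) ?v"
    using vc(1) vd(1) by (rule Bochner_Integration.integrable_diff)
  then have "AE t in lebesgue_on I01. velocity (primitive ?v) t = ?v t"
    by (rule velocity_primitive)
  moreover have "AE t in lebesgue_on I01. velocity (\<lambda>s. c s - d s) t = velocity (primitive ?v) t"
    by (intro AE_I2 velocity_cong) (simp_all add: eq)
  ultimately show ?thesis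
    by eventually_elim simp
qed

lemma AC_dist_eq:
  assumes "c \<in> AC0" "d \<in> AC0"
  shows "AC_dist c d = (LINT t|lebesgue_on I01. norm (velocity c t - velocity d t))"
proof -
  have [measurable]: "velocity c \<in> borel_measurable (lebesgue_on I01)" "velocity d \<in> borel_measurable (lebesgue_on I01)"
    by (rule borel_measurable_integrable[OF AC0_velocity(1)], rule assms)+
  have ae: "AE t in lebesgue_on I01. velocity c t - velocity d t = velocity (\<lambda>s. c s - d s) t"
    using velocity_diff[OF assms] by eventually_elim simp
  have [measurable]: "velocity (\<lambda>s. c s - d s) \<in> borel_measurable (lebesgue_on I01)"
    by (rule borel_measurable_lebesgue_on_AE[OF _ _ ae]) auto
  show ?thesis
    unfolding AC_dist_def AC_norm_def
  proof (rule integral_cong_AE)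
    show "AE t in lebesgue_on I01. norm (velocity (\<lambda>s. c s - d s) t) = norm (velocity c t - velocity d t)"
      using ae by eventually_elim simp
  qed measurable
qed

lemma AC_dist_commute: "AC_dist c d = AC_dist d c"
proof -
  have "norm (velocity (\<lambda>s. c s - d s) t) = norm (velocity (\<lambda>s. d s - c s) t)" if "t \<in> I01" for t
    using norm_velocity_minus[OF that, of "\<lambda>s. d s - c s"] by simp
  then show ?thesis
    unfolding AC_dist_def AC_norm_def by (intro Bochner_Integration.integral_cong) auto
qed

lemma Metric_space_AC0: "Metric_space (AC0 :: (real \<Rightarrow> real ^ 'n) set) AC_dist"
proof
  fix c d e :: "real \<Rightarrow> real ^ 'n"
  show "0 \<le> AC_dist c d"
    by (simp add: AC_dist_def AC_norm_def)
  show "AC_dist c d = AC_dist d c"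
    by (rule AC_dist_commute)
  assume c: "c \<in> AC0" and d: "d \<in> AC0"
  have int: "integrable (lebesgue_on I01) (\<lambda>t. norm (velocity c t - velocity d t))"
    if "c \<in> AC0" "d \<in> AC0" for c d :: "real \<Rightarrow> real ^ 'n"
    by (rule integrable_norm[OF Bochner_Integration.integrable_diff[OF AC0_velocity(1)[OF that(1)] AC0_velocity(1)[OF that(2)]]])
  show "AC_dist c d = 0 \<longleftrightarrow> c = d"
  proof
    assume "AC_dist c d = 0"
    then have "AE t in lebesgue_on I01. norm (velocity c t - velocity d t) = 0"
      unfolding AC_dist_eq[OF c d] using int[OF c d] by (subst (asm) integral_nonneg_eq_0_iff_AE) auto
    then have "AE t in lebesgue_on I01. velocity c t = velocity d t"
      by eventually_elim simp
    then show "c = d"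
      using primitive_cong_AE[of "velocity c" "velocity d"] AC0_velocity(2)[OF c] AC0_velocity(2)[OF d] by simp
  next
    assume "c = d"
    then show "AC_dist c d = 0"
      using AC_dist_eq[OF c d] by simp
  qed
  assume e: "e \<in> AC0"
  have "(LINT t|lebesgue_on I01. norm (velocity c t - velocity e t)) \<le>
      (LINT t|lebesgue_on I01. norm (velocity c t - velocity d t) + norm (velocity d t - velocity e t))"
  proof (rule integral_mono[OF int[OF c e] Bochner_Integration.integrable_add[OF int[OF c d] int[OF d e]]])
    show "norm (velocity c t - velocity e t) \<le> norm (velocity c t - velocity d t) + norm (velocity d t - velocity e t)" for t
      using norm_triangle_ineq[of "velocity c t - velocity d t" "velocity d t - velocity e t"] by simp
  qed
  also have "\<dots> = AC_dist c d + AC_dist d e"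
    unfolding AC_dist_eq[OF c d] AC_dist_eq[OF d e]
    by (rule Bochner_Integration.integral_add[OF int[OF c d] int[OF d e]])
  finally show "AC_dist c e \<le> AC_dist c d + AC_dist d e"
    unfolding AC_dist_eq[OF c e] .
qed

section \<open>The pointwise map and its inverse\<close>

definition V_inv :: "real ^ 'n \<Rightarrow> real ^ 'n" where
  "V_inv y = norm y *\<^sub>R y"

lemma norm_V_inv: "norm (V_inv y) = (norm y)\<^sup>2"
  by (simp add: V_inv_def power2_eq_square)

lemma norm_V: "(norm (V x))\<^sup>2 = norm x"
  by (simp add: V_def power_mult_distrib power_divide power2_eq_square field_simps)

lemma V_inv_V: "V_inv (V x) = x"
proof (cases "x = 0")
  case False
  have "norm (V x) = sqrt (norm x)"
    using norm_V[of x] by (metis norm_ge_zero real_sqrt_unique)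
  then show ?thesis
    using False by (simp add: V_inv_def V_def)
qed (simp add: V_inv_def V_def)

lemma V_V_inv: "V (V_inv y) = y"
proof (cases "y = 0")
  case False
  then have "sqrt (norm (V_inv y)) = norm y"
    by (simp add: norm_V_inv)
  then show ?thesis
    using False by (simp add: V_def V_inv_def)
qed (simp add: V_inv_def V_def)

text \<open>
  Strong monotonicity of \<^const>\<open>V_inv\<close>, the gradient of \<open>\<bar>y\<bar>\<^sup>3 / 3\<close>: its increment paired with \<open>p - q\<close> equals
  \<open>(\<bar>p\<bar> + \<bar>q\<bar>) (\<bar>p - q\<bar>\<^sup>2 + (\<bar>p\<bar> - \<bar>q\<bar>)\<^sup>2) / 2\<close>, which is at least \<open>\<bar>p - q\<bar>\<^sup>3 / 2\<close>. The Cauchy-Schwarz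
  inequality then allows division by \<open>\<bar>p - q\<bar>\<close>.
\<close>

lemma norm_diff_square_le_V_inv:
  "(norm (p - q))\<^sup>2 \<le> 2 * norm (V_inv p - V_inv q)"
proof (cases "p = q")
  case False
  then have pos: "0 < norm (p - q)" by simp
  define a b s where "a = norm p" and "b = norm q" and "s = p \<bullet> q"
  have ab: "0 \<le> a" "0 \<le> b"
    by (simp_all add: a_def b_def)
  have tri: "norm (p - q) \<le> a + b"
    unfolding a_def b_def by (rule norm_triangle_ineq4)
  have sq: "(norm (p - q))\<^sup>2 = a\<^sup>2 + b\<^sup>2 - 2 * s"
    unfolding a_def b_def s_def power2_norm_eq_inner
    by (simp add: inner_diff_left inner_diff_right inner_commute)
  have "(V_inv p - V_inv q) \<bullet> (p - q) = a * (p \<bullet> p) + b * (q \<bullet> q) - (a + b) * s"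
    unfolding V_inv_def a_def b_def s_def
    by (simp add: inner_diff_left inner_diff_right inner_commute algebra_simps)
  also have "\<dots> = a * a\<^sup>2 + b * b\<^sup>2 - (a + b) * s"
    by (simp add: a_def b_def power2_norm_eq_inner)
  also have "\<dots> = (a + b) * ((norm (p - q))\<^sup>2 + (a - b)\<^sup>2) / 2"
    unfolding sq by (simp add: power2_eq_square algebra_simps)
  finally have inner: "(V_inv p - V_inv q) \<bullet> (p - q) = (a + b) * ((norm (p - q))\<^sup>2 + (a - b)\<^sup>2) / 2" .
  have "norm (p - q) * (norm (p - q))\<^sup>2 \<le> (a + b) * ((norm (p - q))\<^sup>2 + (a - b)\<^sup>2)"
    using tri ab by (intro mult_mono) auto
  also have "\<dots> = 2 * ((V_inv p - V_inv q) \<bullet> (p - q))"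
    unfolding inner by simp
  also have "\<dots> \<le> 2 * (norm (V_inv p - V_inv q) * norm (p - q))"
    using norm_cauchy_schwarz by (intro mult_left_mono) auto
  finally have "norm (p - q) * (norm (p - q))\<^sup>2 \<le> norm (p - q) * (2 * norm (V_inv p - V_inv q))"
    by (simp add: mult.commute mult.left_commute)
  then show ?thesis
    using pos by (rule mult_left_le_imp_le)
qed simp

lemma norm_V_diff: "(norm (V x - V y))\<^sup>2 \<le> 2 * norm (x - y)"
  using norm_diff_square_le_V_inv[of "V x" "V y"] by (simp add: V_inv_V)

text \<open>
  From \<open>V_inv p - V_inv q = \<bar>p\<bar> (p - q) + (\<bar>p\<bar> - \<bar>q\<bar>) q\<close> one gets the bound \<open>2 \<bar>p\<bar> \<bar>p - q\<bar> + \<bar>p - q\<bar>\<^sup>2\<close>. Young's inequality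
  with a free parameter \<open>\<eta>\<close> separates the factors of the mixed term, so that each summand can be integrated.
\<close>

lemma norm_V_inv_diff:
  assumes "\<eta> > 0"
  shows "norm (V_inv p - V_inv q) \<le> \<eta> * (norm p)\<^sup>2 + (1 / \<eta> + 1) * (norm (p - q))\<^sup>2"
proof -
  have "V_inv p - V_inv q = norm p *\<^sub>R (p - q) + (norm p - norm q) *\<^sub>R q"
    by (simp add: V_inv_def algebra_simps)
  then have "norm (V_inv p - V_inv q) \<le> norm p * norm (p - q) + \<bar>norm p - norm q\<bar> * norm q"
    using norm_triangle_ineq[of "norm p *\<^sub>R (p - q)" "(norm p - norm q) *\<^sub>R q"] by simp
  also have "\<bar>norm p - norm q\<bar> * norm q \<le> norm (p - q) * (norm p + norm (p - q))"
    using norm_triangle_ineq3[of p q] norm_triangle_sub[of q p]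
    by (intro mult_mono) (auto simp: norm_minus_commute)
  also have "norm p * norm (p - q) + norm (p - q) * (norm p + norm (p - q)) =
      2 * (norm p * norm (p - q)) + (norm (p - q))\<^sup>2"
    by (simp add: power2_eq_square algebra_simps)
  also have "2 * (norm p * norm (p - q)) \<le> \<eta> * (norm p)\<^sup>2 + (norm (p - q))\<^sup>2 / \<eta>"
  proof -
    have "0 \<le> (\<eta> * norm p - norm (p - q))\<^sup>2 / \<eta>"
      using assms by simp
    also have "\<dots> = \<eta> * (norm p)\<^sup>2 + (norm (p - q))\<^sup>2 / \<eta> - 2 * (norm p * norm (p - q))"
      using assms by (simp add: power2_eq_square field_simps)
    finally show ?thesis by simp
  qed
  finally show ?thesis
    by (simp add: algebra_simps)
qed

lemma continuous_on_V: "continuous_on UNIV (V :: real ^ 'n \<Rightarrow> real ^ 'n)"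
  unfolding continuous_on_iff
proof (intro ballI allI impI)
  fix x :: "real ^ 'n" and \<epsilon> :: real assume "\<epsilon> > 0"
  show "\<exists>d>0. \<forall>y\<in>UNIV. dist y x < d \<longrightarrow> dist (V y) (V x) < \<epsilon>"
  proof (intro exI[of _ "\<epsilon>\<^sup>2 / 2"] conjI ballI impI)
    fix y assume "dist y x < \<epsilon>\<^sup>2 / 2"
    then have "(norm (V y - V x))\<^sup>2 < \<epsilon>\<^sup>2"
      using norm_V_diff[of y x] by (simp add: dist_norm)
    then show "dist (V y) (V x) < \<epsilon>"
      using \<open>\<epsilon> > 0\<close> by (simp add: dist_norm power_less_imp_less_base)
  qed (use \<open>\<epsilon> > 0\<close> in simp)
qed

lemma borel_measurable_V [measurable]: "V \<in> borel_measurable borel"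
  by (rule borel_measurable_continuous_onI[OF continuous_on_V])

lemma borel_measurable_V_inv [measurable]: "V_inv \<in> borel_measurable borel"
  unfolding V_inv_def by measurable

lemma square_integrable_V:
  assumes "integrable (lebesgue_on I01) f"
  shows "(\<lambda>t. V (f t)) \<in> square_integrable"
proof -
  have [measurable]: "f \<in> borel_measurable (lebesgue_on I01)"
    using assms by (rule borel_measurable_integrable)
  have "(\<lambda>t. V (f t)) \<in> borel_measurable (lebesgue_on I01)"
    by measurable
  then show ?thesis
    using integrable_norm[OF assms] by (simp add: square_integrable_def norm_V)
qed

lemma integrable_V_inv:
  assumes "f \<in> square_integrable"
  shows "integrable (lebesgue_on I01) (\<lambda>t. V_inv (f t))"
proof -
  have [measurable]: "f \<in> borel_measurable (lebesgue_on I01)"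
    using assms by (simp add: square_integrable_def)
  have "(\<lambda>t. V_inv (f t)) \<in> borel_measurable (lebesgue_on I01)"
    by measurable
  moreover have "integrable (lebesgue_on I01) (\<lambda>t. norm (V_inv (f t)))"
    using assms by (simp add: square_integrable_def norm_V_inv)
  ultimately show ?thesis
    by (simp add: integrable_norm_iff)
qed

section \<open>The metric on square integrable functions\<close>

text \<open>
  The weighted form \<open>\<bar>u + v\<bar>\<^sup>2 \<le> (\<alpha> + \<beta>) (\<bar>u\<bar>\<^sup>2 / \<alpha> + \<bar>v\<bar>\<^sup>2 / \<beta>)\<close> of convexity can be integrated directly, and
  becomes Minkowski's inequality when the weights are the norms of the two functions.
\<close>

lemma square_integrable_add_scaled:
  assumes f: "f \<in> square_integrable" and g: "g \<in> square_integrable"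
    and "0 < \<alpha>" "0 < \<beta>"
  shows "integrable (lebesgue_on I01) (\<lambda>t. (norm (f t + g t))\<^sup>2)"
    and "(LINT t|lebesgue_on I01. (norm (f t + g t))\<^sup>2) \<le>
      (\<alpha> + \<beta>) * ((LINT t|lebesgue_on I01. (norm (f t))\<^sup>2) / \<alpha> + (LINT t|lebesgue_on I01. (norm (g t))\<^sup>2) / \<beta>)"
proof -
  have [measurable]: "f \<in> borel_measurable (lebesgue_on I01)" "g \<in> borel_measurable (lebesgue_on I01)"
    and fi: "integrable (lebesgue_on I01) (\<lambda>t. (norm (f t))\<^sup>2)"
    and gi: "integrable (lebesgue_on I01) (\<lambda>t. (norm (g t))\<^sup>2)"
    using f g by (simp_all add: square_integrable_def)
  let ?h = "\<lambda>t. (\<alpha> + \<beta>) * ((norm (f t))\<^sup>2 / \<alpha> + (norm (g t))\<^sup>2 / \<beta>)"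
  have pointwise: "(norm (u + v))\<^sup>2 \<le> (\<alpha> + \<beta>) * ((norm u)\<^sup>2 / \<alpha> + (norm v)\<^sup>2 / \<beta>)" for u v :: "real ^ 'n"
  proof -
    have "(norm (u + v))\<^sup>2 \<le> (norm u + norm v)\<^sup>2"
      by (intro power_mono norm_triangle_ineq) simp
    also have "\<dots> \<le> (norm u + norm v)\<^sup>2 + (\<beta> * norm u - \<alpha> * norm v)\<^sup>2 / (\<alpha> * \<beta>)"
      using \<open>0 < \<alpha>\<close> \<open>0 < \<beta>\<close> by simp
    also have "\<dots> = (\<alpha> + \<beta>) * ((norm u)\<^sup>2 / \<alpha> + (norm v)\<^sup>2 / \<beta>)"
      using \<open>0 < \<alpha>\<close> \<open>0 < \<beta>\<close> by (simp add: power2_eq_square field_simps)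
    finally show ?thesis .
  qed
  have hi: "integrable (lebesgue_on I01) ?h"
    using fi gi by (intro integrable_mult_right Bochner_Integration.integrable_add integrable_divide)
  show i: "integrable (lebesgue_on I01) (\<lambda>t. (norm (f t + g t))\<^sup>2)"
  proof (rule Bochner_Integration.integrable_bound[OF hi])
    show "AE t in lebesgue_on I01. norm ((norm (f t + g t))\<^sup>2) \<le> norm (?h t)"
    proof (rule AE_I2)
      fix t show "norm ((norm (f t + g t))\<^sup>2) \<le> norm (?h t)"
        using pointwise[of "f t" "g t"] by simp
    qed
  qed measurable
  have "(LINT t|lebesgue_on I01. (norm (f t + g t))\<^sup>2) \<le> (LINT t|lebesgue_on I01. ?h t)"
    by (rule integral_mono[OF i hi pointwise])
  also have "\<dots> = (\<alpha> + \<beta>) * ((LINT t|lebesgue_on I01. (norm (f t))\<^sup>2) / \<alpha> + (LINT t|lebesgue_on I01. (norm (g t))\<^sup>2) / \<beta>)"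
    using fi gi by (simp add: Bochner_Integration.integral_add)
  finally show "(LINT t|lebesgue_on I01. (norm (f t + g t))\<^sup>2) \<le>
      (\<alpha> + \<beta>) * ((LINT t|lebesgue_on I01. (norm (f t))\<^sup>2) / \<alpha> + (LINT t|lebesgue_on I01. (norm (g t))\<^sup>2) / \<beta>)" .
qed

lemma square_integrable_diff:
  assumes f: "f \<in> square_integrable" and g: "g \<in> square_integrable"
  shows "(\<lambda>t. f t - g t) \<in> square_integrable"
proof -
  have [measurable]: "f \<in> borel_measurable (lebesgue_on I01)" "g \<in> borel_measurable (lebesgue_on I01)"
    using f g by (simp_all add: square_integrable_def)
  have "(\<lambda>t. - g t) \<in> square_integrable"
    using g by (simp add: square_integrable_def)
  from square_integrable_add_scaled(1)[OF f this zero_less_one zero_less_one]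
  show ?thesis
    by (simp add: square_integrable_def)
qed

text \<open>
  Norms may vanish, so the weights are the norms increased by \<open>e/2\<close>.
\<close>

lemma Minkowski_square_integrable:
  assumes f: "f \<in> square_integrable" and g: "g \<in> square_integrable"
  shows "sqrt (LINT t|lebesgue_on I01. (norm (f t + g t))\<^sup>2) \<le>
    sqrt (LINT t|lebesgue_on I01. (norm (f t))\<^sup>2) + sqrt (LINT t|lebesgue_on I01. (norm (g t))\<^sup>2)"
proof (rule field_le_epsilon)
  fix e :: real assume "0 < e"
  define A B where "A = (LINT t|lebesgue_on I01. (norm (f t))\<^sup>2)" and "B = (LINT t|lebesgue_on I01. (norm (g t))\<^sup>2)"
  have AB: "0 \<le> A" "0 \<le> B"
    by (simp_all add: A_def B_def)
  define \<alpha> \<beta> where "\<alpha> = sqrt A + e/2" and "\<beta> = sqrt B + e/2"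
  have pos: "0 < \<alpha>" "0 < \<beta>"
    using \<open>0 < e\<close> AB by (simp_all add: \<alpha>_def \<beta>_def add_nonneg_pos)
  have quot: "X / (sqrt X + e/2) \<le> sqrt X + e/2" if "0 \<le> X" for X
  proof -
    have "X = sqrt X * sqrt X"
      using that by simp
    also have "\<dots> \<le> (sqrt X + e/2) * (sqrt X + e/2)"
      using that \<open>0 < e\<close> by (intro mult_mono) auto
    finally have "X \<le> (sqrt X + e/2) * (sqrt X + e/2)" .
    moreover have "0 < sqrt X + e/2"
      using that \<open>0 < e\<close> by (simp add: add_nonneg_pos)
    ultimately show ?thesis
      by (subst pos_divide_le_eq)
  qed
  have "(LINT t|lebesgue_on I01. (norm (f t + g t))\<^sup>2) \<le> (\<alpha> + \<beta>) * (A / \<alpha> + B / \<beta>)"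
    using square_integrable_add_scaled(2)[OF f g pos] by (simp add: A_def B_def)
  also have "\<dots> \<le> (\<alpha> + \<beta>) * (\<alpha> + \<beta>)"
    using quot[OF AB(1)] quot[OF AB(2)] pos unfolding \<alpha>_def[symmetric] \<beta>_def[symmetric]
    by (intro mult_left_mono add_mono) auto
  finally have "sqrt (LINT t|lebesgue_on I01. (norm (f t + g t))\<^sup>2) \<le> \<alpha> + \<beta>"
    using pos by (intro real_le_lsqrt) (auto simp: power2_eq_square)
  then show "sqrt (LINT t|lebesgue_on I01. (norm (f t + g t))\<^sup>2) \<le>
    sqrt (LINT t|lebesgue_on I01. (norm (f t))\<^sup>2) + sqrt (LINT t|lebesgue_on I01. (norm (g t))\<^sup>2) + e"
    by (simp add: A_def B_def \<alpha>_def \<beta>_def)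
qed

lemma L2_cases:
  assumes "F \<in> L2"
  obtains f where "f \<in> square_integrable" "F = L2_class f"
  using assms unfolding L2_def L2_class_def by (rule quotientE)

lemma L2_class_in_L2: "f \<in> square_integrable \<Longrightarrow> L2_class f \<in> L2"
  unfolding L2_def L2_class_def by (rule quotientI)

lemma L2_class_eq_iff:
  assumes "f \<in> square_integrable" "g \<in> square_integrable"
  shows "L2_class f = L2_class g \<longleftrightarrow> (AE t in lebesgue_on I01. f t = g t)"
  unfolding L2_class_def eq_equiv_class_iff[OF equiv_ae_eq assms] using assms by (simp add: ae_eq_def)

lemma Metric_space_L2: "Metric_space (L2 :: (real \<Rightarrow> real ^ 'n) set set) L2_dist"
proof
  fix F G H :: "(real \<Rightarrow> real ^ 'n) set"
  show "0 \<le> L2_dist F G"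
    by (simp add: L2_dist_def Let_def)
  show "L2_dist F G = L2_dist G F"
    by (simp add: L2_dist_def Let_def norm_minus_commute)
  assume "F \<in> L2" "G \<in> L2"
  obtain f where f: "f \<in> square_integrable" "F = L2_class f"
    using \<open>F \<in> L2\<close> by (rule L2_cases)
  obtain g where g: "g \<in> square_integrable" "G = L2_class g"
    using \<open>G \<in> L2\<close> by (rule L2_cases)
  note fg = square_integrable_diff[OF f(1) g(1)]
  show "L2_dist F G = 0 \<longleftrightarrow> F = G"
  proof -
    have "L2_dist F G = 0 \<longleftrightarrow> (LINT t|lebesgue_on I01. (norm (f t - g t))\<^sup>2) = 0"
      unfolding f(2) g(2) L2_dist_class[OF f(1) g(1)] by simp
    also have "\<dots> \<longleftrightarrow> (AE t in lebesgue_on I01. (norm (f t - g t))\<^sup>2 = 0)"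
      using fg by (intro integral_nonneg_eq_0_iff_AE) (auto simp: square_integrable_def)
    also have "\<dots> \<longleftrightarrow> F = G"
      unfolding f(2) g(2) L2_class_eq_iff[OF f(1) g(1)] by simp
    finally show ?thesis .
  qed
  assume "H \<in> L2"
  then obtain h where h: "h \<in> square_integrable" "H = L2_class h"
    by (rule L2_cases)
  show "L2_dist F H \<le> L2_dist F G + L2_dist G H"
    unfolding f(2) g(2) h(2) L2_dist_class[OF f(1) g(1)] L2_dist_class[OF f(1) h(1)] L2_dist_class[OF g(1) h(1)]
    using Minkowski_square_integrable[OF fg square_integrable_diff[OF g(1) h(1)]] by simp
qed

section \<open>The square root velocity transform\<close>

text \<open>
  By \<open>SRVT_inv_L2_class\<close> below, the primitive does not depend on the representative of the class.
\<close>

definition SRVT_inv :: "(real \<Rightarrow> real ^ 'n) set \<Rightarrow> real \<Rightarrow> real ^ 'n" where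
  "SRVT_inv F = primitive (\<lambda>t. V_inv ((SOME f. f \<in> F) t))"

lemma SRVT_inv_L2_class:
  assumes f: "f \<in> square_integrable"
  shows "SRVT_inv (L2_class f) = primitive (\<lambda>t. V_inv (f t))"
proof -
  define h where "h = (SOME g. g \<in> L2_class f)"
  have "f \<in> L2_class f"
    using f by (simp add: L2_class_def ae_eq_def)
  then have "h \<in> L2_class f"
    unfolding h_def by (rule someI[where P = "\<lambda>g. g \<in> L2_class f"])
  then have "AE t in lebesgue_on I01. f t = h t"
    by (simp add: L2_class_def ae_eq_def)
  then have "AE t in lebesgue_on I01. V_inv (h t) = V_inv (f t)"
    by eventually_elim simp
  then show ?thesis
    unfolding SRVT_inv_def h_def[symmetric] by (rule primitive_cong_AE)
qed

lemma SRVT_in_L2: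
  assumes "c \<in> AC0"
  shows "SRVT c \<in> L2"
  unfolding SRVT_def by (intro L2_class_in_L2 square_integrable_V AC0_velocity(1)[OF assms])

lemma SRVT_inv_SRVT:
  assumes "c \<in> AC0"
  shows "SRVT_inv (SRVT c) = c"
  unfolding SRVT_def SRVT_inv_L2_class[OF square_integrable_V[OF AC0_velocity(1)[OF assms]]] V_inv_V
  by (rule AC0_velocity(2)[OF assms])

lemma SRVT_SRVT_inv:
  assumes "F \<in> L2"
  shows "SRVT_inv F \<in> AC0" "SRVT (SRVT_inv F) = F"
proof -
  obtain f where f: "f \<in> square_integrable" "F = L2_class f"
    using assms by (rule L2_cases)
  note i = integrable_V_inv[OF f(1)]
  have inv: "SRVT_inv F = primitive (\<lambda>t. V_inv (f t))"
    unfolding f(2) by (rule SRVT_inv_L2_class[OF f(1)])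
  show AC0: "SRVT_inv F \<in> AC0"
    unfolding inv by (rule primitive_in_AC0[OF i])
  have "AE t in lebesgue_on I01. V (velocity (SRVT_inv F) t) = f t"
    using velocity_primitive[OF i] unfolding inv by eventually_elim (simp add: V_V_inv)
  then show "SRVT (SRVT_inv F) = F"
    unfolding SRVT_def f(2)
    using L2_class_eq_iff[OF square_integrable_V[OF AC0_velocity(1)[OF AC0]] f(1)] unfolding f(2) by blast
qed

text \<open>
  The integrated form of the Hoelder estimate for \<^const>\<open>V\<close>.
\<close>

lemma L2_dist_SRVT:
  assumes c: "c \<in> AC0" and d: "d \<in> AC0"
  shows "(L2_dist (SRVT c) (SRVT d))\<^sup>2 \<le> 2 * AC_dist c d"
proof -
  note v = AC0_velocity(1)[OF c] AC0_velocity(1)[OF d]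
  note sv = square_integrable_V[OF v(1)] square_integrable_V[OF v(2)]
  have "(L2_dist (SRVT c) (SRVT d))\<^sup>2 = (LINT t|lebesgue_on I01. (norm (V (velocity c t) - V (velocity d t)))\<^sup>2)"
    unfolding SRVT_def L2_dist_class[OF sv] by simp
  also have "\<dots> \<le> (LINT t|lebesgue_on I01. 2 * norm (velocity c t - velocity d t))"
  proof (rule integral_mono[OF _ _ norm_V_diff])
    show "integrable (lebesgue_on I01) (\<lambda>t. (norm (V (velocity c t) - V (velocity d t)))\<^sup>2)"
      using square_integrable_diff[OF sv] by (simp add: square_integrable_def)
    show "integrable (lebesgue_on I01) (\<lambda>t. 2 * norm (velocity c t - velocity d t))"
      using v by (intro integrable_mult_right integrable_norm Bochner_Integration.integrable_diff)
  qed
  also have "\<dots> = 2 * AC_dist c d"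
    unfolding AC_dist_eq[OF c d] by simp
  finally show ?thesis .
qed

text \<open>
  The integrated form of the estimate for \<^const>\<open>V_inv\<close>. At a fixed \<open>f\<close> a small \<open>\<eta>\<close> makes the first summand small, and
  then a small distance of \<open>g\<close> from \<open>f\<close> the second.
\<close>

lemma AC_dist_SRVT_inv:
  assumes f: "f \<in> square_integrable" and g: "g \<in> square_integrable" and "\<eta> > 0"
  shows "AC_dist (SRVT_inv (L2_class f)) (SRVT_inv (L2_class g)) \<le>
    \<eta> * (LINT t|lebesgue_on I01. (norm (f t))\<^sup>2) + (1 / \<eta> + 1) * (L2_dist (L2_class f) (L2_class g))\<^sup>2"
proof -
  note i = integrable_V_inv[OF f] integrable_V_inv[OF g]
  have fi: "integrable (lebesgue_on I01) (\<lambda>t. (norm (f t))\<^sup>2)"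
    using f by (simp add: square_integrable_def)
  have fgi: "integrable (lebesgue_on I01) (\<lambda>t. (norm (f t - g t))\<^sup>2)"
    using square_integrable_diff[OF f g] by (simp add: square_integrable_def)
  have AC0: "primitive (\<lambda>t. V_inv (f t)) \<in> AC0" "primitive (\<lambda>t. V_inv (g t)) \<in> AC0"
    by (rule primitive_in_AC0[OF i(1)], rule primitive_in_AC0[OF i(2)])
  note [measurable] = borel_measurable_integrable[OF AC0_velocity(1)[OF AC0(1)]]
    borel_measurable_integrable[OF AC0_velocity(1)[OF AC0(2)]]
    borel_measurable_integrable[OF i(1)] borel_measurable_integrable[OF i(2)]
  have "AC_dist (SRVT_inv (L2_class f)) (SRVT_inv (L2_class g)) =
      (LINT t|lebesgue_on I01. norm (velocity (primitive (\<lambda>t. V_inv (f t))) t - velocity (primitive (\<lambda>t. V_inv (g t))) t))"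
    unfolding SRVT_inv_L2_class[OF f] SRVT_inv_L2_class[OF g] by (rule AC_dist_eq[OF AC0])
  also have "\<dots> = (LINT t|lebesgue_on I01. norm (V_inv (f t) - V_inv (g t)))"
  proof (rule integral_cong_AE)
    show "AE t in lebesgue_on I01. norm (velocity (primitive (\<lambda>t. V_inv (f t))) t - velocity (primitive (\<lambda>t. V_inv (g t))) t) =
        norm (V_inv (f t) - V_inv (g t))"
      using velocity_primitive[OF i(1)] velocity_primitive[OF i(2)] by eventually_elim simp
  qed measurable
  also have "\<dots> \<le> (LINT t|lebesgue_on I01. \<eta> * (norm (f t))\<^sup>2 + (1 / \<eta> + 1) * (norm (f t - g t))\<^sup>2)"
    using i fi fgi
    by (intro integral_mono norm_V_inv_diff \<open>\<eta> > 0\<close> integrable_norm Bochner_Integration.integrable_diff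
        Bochner_Integration.integrable_add integrable_mult_right)
  also have "\<dots> = \<eta> * (LINT t|lebesgue_on I01. (norm (f t))\<^sup>2) + (1 / \<eta> + 1) * (LINT t|lebesgue_on I01. (norm (f t - g t))\<^sup>2)"
    using fi fgi by (subst Bochner_Integration.integral_add) (auto intro: integrable_mult_right)
  also have "(LINT t|lebesgue_on I01. (norm (f t - g t))\<^sup>2) = (L2_dist (L2_class f) (L2_class g))\<^sup>2"
    unfolding L2_dist_class[OF f g] by simp
  finally show ?thesis .
qed

lemma continuous_map_SRVT:
  "continuous_map (AC0_topology :: (real \<Rightarrow> real ^ 'n) topology) L2_topology SRVT"
  unfolding AC0_topology_def L2_topology_def
    Metric_space.metric_continuous_map[OF Metric_space_AC0 Metric_space_L2]
proof (intro conjI ballI allI impI)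
  show "SRVT ` AC0 \<subseteq> L2"
    using SRVT_in_L2 by blast
  fix c :: "real \<Rightarrow> real ^ 'n" and \<epsilon> :: real
  assume c: "c \<in> AC0" and "\<epsilon> > 0"
  show "\<exists>\<delta>>0. \<forall>d. d \<in> AC0 \<and> AC_dist c d < \<delta> \<longrightarrow> L2_dist (SRVT c) (SRVT d) < \<epsilon>"
  proof (intro exI[of _ "\<epsilon>\<^sup>2 / 2"] conjI allI impI)
    fix d assume "d \<in> AC0 \<and> AC_dist c d < \<epsilon>\<^sup>2 / 2"
    then have "(L2_dist (SRVT c) (SRVT d))\<^sup>2 < \<epsilon>\<^sup>2"
      using L2_dist_SRVT[OF c, of d] by simp
    then show "L2_dist (SRVT c) (SRVT d) < \<epsilon>"
      using \<open>\<epsilon> > 0\<close> by (simp add: power_less_imp_less_base)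
  qed (use \<open>\<epsilon> > 0\<close> in simp)
qed

lemma continuous_map_SRVT_inv:
  "continuous_map L2_topology (AC0_topology :: (real \<Rightarrow> real ^ 'n) topology) SRVT_inv"
  unfolding AC0_topology_def L2_topology_def
    Metric_space.metric_continuous_map[OF Metric_space_L2 Metric_space_AC0]
proof (intro conjI ballI allI impI)
  show "SRVT_inv ` L2 \<subseteq> AC0"
    using SRVT_SRVT_inv(1) by blast
  fix F :: "(real \<Rightarrow> real ^ 'n) set" and \<epsilon> :: real
  assume "F \<in> L2" and "\<epsilon> > 0"
  obtain f where f: "f \<in> square_integrable" "F = L2_class f"
    using \<open>F \<in> L2\<close> by (rule L2_cases)
  define A where "A = (LINT t|lebesgue_on I01. (norm (f t))\<^sup>2)"
  \<comment> \<open>The \<open>1\<close> in the denominator covers the case \<open>A = 0\<close>.\<close>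
  define \<eta> where "\<eta> = \<epsilon> / 2 / (A + 1)"
  have "0 \<le> A"
    by (simp add: A_def)
  then have \<eta>: "\<eta> > 0" "\<eta> * A \<le> \<epsilon> / 2"
    using \<open>\<epsilon> > 0\<close> by (simp_all add: \<eta>_def field_simps)
  define B where "B = 1 / \<eta> + 1"
  have "B > 0"
    using \<eta>(1) by (simp add: B_def add_pos_pos)
  show "\<exists>\<delta>>0. \<forall>G. G \<in> L2 \<and> L2_dist F G < \<delta> \<longrightarrow> AC_dist (SRVT_inv F) (SRVT_inv G) < \<epsilon>"
  proof (intro exI[of _ "sqrt (\<epsilon> / 2 / B)"] conjI allI impI, goal_cases)
    case 1
    show ?case
      using \<open>\<epsilon> > 0\<close> \<open>B > 0\<close> by simp
  next
    case (2 G)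
    then obtain g where g: "g \<in> square_integrable" "G = L2_class g"
      using L2_cases by blast
    have "0 \<le> L2_dist F G"
      by (simp add: L2_dist_def Let_def)
    then have "(L2_dist F G)\<^sup>2 < (sqrt (\<epsilon> / 2 / B))\<^sup>2"
      using 2 by (intro power_strict_mono) auto
    also have "\<dots> = \<epsilon> / 2 / B"
      using \<open>\<epsilon> > 0\<close> \<open>B > 0\<close> by simp
    finally have "B * (L2_dist F G)\<^sup>2 < \<epsilon> / 2"
      using \<open>B > 0\<close> by (simp add: field_simps)
    moreover have "AC_dist (SRVT_inv F) (SRVT_inv G) \<le> \<eta> * A + B * (L2_dist F G)\<^sup>2"
      using AC_dist_SRVT_inv[OF f(1) g(1) \<eta>(1)] unfolding f(2) g(2) A_def B_def .
    ultimately show ?case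
      using \<eta>(2) by linarith
  qed
qed

theorem lemma3p3:
  shows "homeomorphic_map (AC0_topology :: (real \<Rightarrow> real ^ 'n) topology) L2_topology SRVT"
proof -
  have top: "topspace (AC0_topology :: (real \<Rightarrow> real ^ 'n) topology) = AC0"
      "topspace (L2_topology :: (real \<Rightarrow> real ^ 'n) set topology) = L2"
    unfolding AC0_topology_def L2_topology_def
    by (rule Metric_space.topspace_mtopology[OF Metric_space_AC0],
        rule Metric_space.topspace_mtopology[OF Metric_space_L2])
  have "homeomorphic_maps (AC0_topology :: (real \<Rightarrow> real ^ 'n) topology) L2_topology SRVT SRVT_inv"
    unfolding homeomorphic_maps_def top
    using continuous_map_SRVT continuous_map_SRVT_inv SRVT_inv_SRVT SRVT_SRVT_inv(2) by blast
  then show ?thesis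
    by (rule homeomorphic_maps_imp_map)
qed

end
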